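(* If $x\neq 0$, then the algebra $\mathbb{L}_n(x)$ is semisimple.
   Context: Let $K$ be a field, $x$ an element transcendental or algebraic over $K$, and $F=K(x)$, assumed of characteristic zero; "semisimple" means isomorphic to a finite direct product of full matrix algebras over $F$. Let $\mathscr{A}_n$ be the set of graphs on $\{1,\dots,n\}\cup\{1',\dots,n'\}$ (top row $1,\dots,n$, bottom row $1',\dots,n'$) in which every vertex has degree $0$ or $1$ (degree-$0$ vertices are said to carry loops). Arcs within a row are horizontal, arcs between rows vertical. For diagrams $\mathfrak a,\mathfrak b$, stack $\mathfrak a$ above $\mathfrak b$ identifying bottom vertex $i'$ of $\mathfrak a$ with top vertex $i$ of $\mathfrak b$; let $\ell(\mathfrak a,\mathfrak b)$ be the number of components lying entirely in the middle row and $G'(\mathfrak a,\mathfrak b)$ the diagram on the outer rows joining two vertices iff they are connected by a path; set $\mathfrak a\mathfrak b=x^{\ell(\mathfrak a,\mathfrak b)}G'(\mathfrak a,\mathfrak b)$. $\mathbb{L}_n(x)$ is the $F$-algebra with basis the diagrams in $\mathscr{A}_n$ having no horizontal arcs and this (bilinearly extended) product. *)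

theory Defs
  imports Main
begin

datatype vtx = Top nat | Bot nat

definition vertices :: "nat \<Rightarrow> vtx set" where
  "vertices n = Top ` {1..n} \<union> Bot ` {1..n}"

text \<open>A diagram is a graph given by its set of edges (two-element vertex sets).\<close>
type_synonym diagram = "vtx set set"

definition degree :: "diagram \<Rightarrow> vtx \<Rightarrow> nat" where
  "degree D v = card {e \<in> D. v \<in> e}"

definition diagrams :: "nat \<Rightarrow> diagram set" where
  "diagrams n = {D. (\<forall>e\<in>D. \<exists>u v. u \<noteq> v \<and> u \<in> vertices n \<and> v \<in> vertices n \<and> e = {u, v})
                    \<and> (\<forall>v \<in> vertices n. degree D v \<le> 1)}"

definition is_horizontal :: "vtx set \<Rightarrow> bool" where
  "is_horizontal e \<longleftrightarrow> (\<exists>i j. e = {Top i, Top j}) \<or> (\<exists>i j. e = {Bot i, Bot j})"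

definition Ln_basis :: "nat \<Rightarrow> diagram set" where
  "Ln_basis n = {D \<in> diagrams n. \<forall>e\<in>D. \<not> is_horizontal e}"

datatype svtx = Up nat | Mid nat | Down nat

definition upper :: "vtx \<Rightarrow> svtx" where
  "upper v = (case v of Top i \<Rightarrow> Up i | Bot i \<Rightarrow> Mid i)"

definition lower :: "vtx \<Rightarrow> svtx" where
  "lower v = (case v of Top i \<Rightarrow> Mid i | Bot i \<Rightarrow> Down i)"

definition stack_edges :: "diagram \<Rightarrow> diagram \<Rightarrow> (svtx \<times> svtx) set" where
  "stack_edges a b = {(u, w). \<exists>e\<in>a. \<exists>p q. e = {p, q} \<and> u = upper p \<and> w = upper q}
                    \<union> {(u, w). \<exists>e\<in>b. \<exists>p q. e = {p, q} \<and> u = lower p \<and> w = lower q}"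

definition connected_st :: "diagram \<Rightarrow> diagram \<Rightarrow> svtx \<Rightarrow> svtx \<Rightarrow> bool" where
  "connected_st a b u w \<longleftrightarrow> (u, w) \<in> (stack_edges a b)\<^sup>*"

definition outer :: "nat \<Rightarrow> svtx \<Rightarrow> vtx option" where
  "outer n s = (case s of Up i \<Rightarrow> if i \<in> {1..n} then Some (Top i) else None
                       | Down i \<Rightarrow> if i \<in> {1..n} then Some (Bot i) else None
                       | Mid i \<Rightarrow> None)"

definition Gprime :: "nat \<Rightarrow> diagram \<Rightarrow> diagram \<Rightarrow> diagram" where
  "Gprime n a b = {{p, q} | p q u w. u \<noteq> w \<and> outer n u = Some p \<and> outer n w = Some q
                               \<and> connected_st a b u w}"

definition ell :: "nat \<Rightarrow> diagram \<Rightarrow> diagram \<Rightarrow> nat" where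
  "ell n a b = card {C. \<exists>j\<in>{1..n}. C = {w. connected_st a b (Mid j) w}
                          \<and> (\<forall>w\<in>C. \<exists>m. w = Mid m)}"

definition Ln_carrier :: "nat \<Rightarrow> (diagram \<Rightarrow> 'a::field) set" where
  "Ln_carrier n = {f. \<forall>D. D \<notin> Ln_basis n \<longrightarrow> f D = 0}"

definition Ln_mult :: "'a::field \<Rightarrow> nat \<Rightarrow> (diagram \<Rightarrow> 'a) \<Rightarrow> (diagram \<Rightarrow> 'a) \<Rightarrow> (diagram \<Rightarrow> 'a)" where
  "Ln_mult x n f g = (\<lambda>c. \<Sum>a\<in>Ln_basis n. \<Sum>b\<in>Ln_basis n.
        if Gprime n a b = c then x ^ ell n a b * f a * g b else 0)"

text \<open>\<open>M_{d 0}(F) \<times> ... \<times> M_{d (k-1)}(F)\<close>: an element is M with M i r c the (r,c) entry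
  (0-based) of the i-th component.\<close>
definition MP_carrier :: "nat \<Rightarrow> (nat \<Rightarrow> nat) \<Rightarrow> (nat \<Rightarrow> nat \<Rightarrow> nat \<Rightarrow> 'a::field) set" where
  "MP_carrier k d = {M. \<forall>i r c. \<not> (i < k \<and> r < d i \<and> c < d i) \<longrightarrow> M i r c = 0}"

definition MP_mult :: "nat \<Rightarrow> (nat \<Rightarrow> nat) \<Rightarrow> (nat \<Rightarrow> nat \<Rightarrow> nat \<Rightarrow> 'a::field)
                        \<Rightarrow> (nat \<Rightarrow> nat \<Rightarrow> nat \<Rightarrow> 'a) \<Rightarrow> (nat \<Rightarrow> nat \<Rightarrow> nat \<Rightarrow> 'a)" where
  "MP_mult k d M N = (\<lambda>i r c. if i < k \<and> r < d i \<and> c < d i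
                              then (\<Sum>s<d i. M i r s * N i s c) else 0)"

definition Ln_semisimple :: "'a::field \<Rightarrow> nat \<Rightarrow> bool" where
  "Ln_semisimple x n \<longleftrightarrow>
     (\<exists>k d (\<phi> :: (diagram \<Rightarrow> 'a) \<Rightarrow> (nat \<Rightarrow> nat \<Rightarrow> nat \<Rightarrow> 'a)).
        (\<forall>i<k. d i \<ge> 1)
      \<and> bij_betw \<phi> (Ln_carrier n) (MP_carrier k d)
      \<and> (\<forall>f\<in>Ln_carrier n. \<forall>g\<in>Ln_carrier n. \<phi> (\<lambda>D. f D + g D) = (\<lambda>i r s. \<phi> f i r s + \<phi> g i r s))
      \<and> (\<forall>c. \<forall>f\<in>Ln_carrier n. \<phi> (\<lambda>D. c * f D) = (\<lambda>i r s. c * \<phi> f i r s))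
      \<and> (\<forall>f\<in>Ln_carrier n. \<forall>g\<in>Ln_carrier n. \<phi> (Ln_mult x n f g) = MP_mult k d (\<phi> f) (\<phi> g)))"

end

theory Submission
  imports Defs "HOL-Library.Poly_Mapping" "HOL-Combinatorics.Permutations" "HOL.Vector_Spaces"
begin

text \<open>
  A diagram without horizontal arcs is a partial injection of \<open>{1..n}\<close>, and multiplying a diagram
  of rank \<open>k\<close> by \<open>x\<close> to the power \<open>n - k\<close> identifies the algebra with the monoid algebra of the
  rook monoid. By Moebius inversion over partial identities, the corners of the latter are the group
  algebras of the symmetric groups, so it suffices to split the identity of each of these into
  orthogonal idempotents \<open>e\<close> with \<open>e A e = F e\<close>; such a family in a semiprime algebra yields matrix
  units.

  For the symmetric groups this is done by induction along the chain of group algebras, in the style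
  of Okounkov and Vershik. If \<open>e\<close> is an idempotent of the family for \<open>S\<^sub>n\<close>, the corner \<open>e A e\<close> of the
  next group algebra is spanned by \<open>e\<close> and by inverses of \<open>Y - c\<close>, where \<open>Y\<close> is the next
  Jucys-Murphy element and \<open>c\<close> runs over eigenvalues of the previous one. Hence \<open>e A e\<close> is
  commutative, and it has no nilpotents by Maschke's theorem. An intertwiner shows that \<open>Y\<close> is
  annihilated by a product of linear factors over \<open>F\<close>, so the eigenprojections of \<open>Y\<close> refine \<open>e\<close>.
\<close>

section \<open>Split families of idempotents\<close>

text \<open>The field need not be algebraically closed, so Wedderburn's theorem alone would leave
  division algebras in the blocks. Demanding \<open>e A e = F e\<close> rules them out, but then
  every eigenvalue must be produced inside the field. This works because a list of roots for one
  Jucys-Murphy element, extended by \<open>c + 1\<close> and \<open>c - 1\<close>, serves for the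
  next one, where \<open>c\<close> is the eigenvalue of the previous element. The induction has to
  carry two consecutive levels. Passing from S_n to S_{n+1} adds one adjacent transposition, and it
  commutes only with S_{n-1}; the idempotents of S_{n-1} therefore make products between different
  branches vanish. Two idempotents in the same branch are separated by multiplicity-freeness, which
  is itself a by-product of the eigenvalue argument. No tableaux, dimensions or explicit spectra
  occur.\<close>

locale field_algebra = vector_space scale
  for scale :: "'a::field \<Rightarrow> 'r::ring_1 \<Rightarrow> 'r" (infixr \<open>*s\<close> 75) +
  assumes scale_mult_left [simp]: "(c *s u) * v = c *s (u * v)"
    and scale_mult_right [simp]: "u * (c *s v) = c *s (u * v)"
begin

definition subalg :: "'r set \<Rightarrow> bool" where
  "subalg A \<longleftrightarrow> subspace A \<and> (\<forall>u\<in>A. \<forall>v\<in>A. u * v \<in> A)"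

text \<open>Completeness is kept out of the notion because the unit of \<open>A\<close> may differ
  from \<open>1\<close>; in the rook algebra it is \<open>mon (idr {1..n})\<close>.\<close>

definition split_family :: "'r set \<Rightarrow> 'r set \<Rightarrow> bool" where
  "split_family A E \<longleftrightarrow> finite E \<and> E \<subseteq> A \<and> 0 \<notin> E \<and> (\<forall>e\<in>E. e * e = e) \<and>
     (\<forall>e\<in>E. \<forall>g\<in>E. e \<noteq> g \<longrightarrow> e * g = 0) \<and> (\<forall>e\<in>E. \<forall>a\<in>A. \<exists>c. e * a * e = c *s e)"

text \<open>Semiprimeness restricted to the spaces \<open>e A g\<close>: enough for matrix units,
  and checkable one corner at a time.\<close>

definition corner_semiprime :: "'r set \<Rightarrow> 'r set \<Rightarrow> bool" where
  "corner_semiprime A E \<longleftrightarrow> (\<forall>e\<in>E. \<forall>g\<in>E. \<forall>a\<in>A. e * a * g \<noteq> 0 \<longrightarrow>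
     (\<exists>b\<in>A. (e * a * g) * b * (e * a * g) \<noteq> 0))"

lemma subalg_mult: "subalg A \<Longrightarrow> u \<in> A \<Longrightarrow> v \<in> A \<Longrightarrow> u * v \<in> A"
  by (simp add: subalg_def)

lemma subalg_subspace: "subalg A \<Longrightarrow> subspace A"
  by (simp add: subalg_def)

lemma subalg_add: "subalg A \<Longrightarrow> u \<in> A \<Longrightarrow> v \<in> A \<Longrightarrow> u + v \<in> A"
  by (simp add: subalg_def subspace_add)

lemma subalg_diff: "subalg A \<Longrightarrow> u \<in> A \<Longrightarrow> v \<in> A \<Longrightarrow> u - v \<in> A"
  by (simp add: subalg_def subspace_diff)

lemma subalg_scale: "subalg A \<Longrightarrow> u \<in> A \<Longrightarrow> c *s u \<in> A"
  by (simp add: subalg_def subspace_scale)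

lemma subalg_sum: "subalg A \<Longrightarrow> (\<And>i. i \<in> I \<Longrightarrow> f i \<in> A) \<Longrightarrow> sum f I \<in> A"
  by (simp add: subalg_def subspace_sum)

lemma split_familyD:
  assumes "split_family A E" "e \<in> E"
  shows "e \<in> A" "e \<noteq> 0" "e * e = e" "g \<in> E \<Longrightarrow> e \<noteq> g \<Longrightarrow> e * g = 0"
    "a \<in> A \<Longrightarrow> \<exists>c. e * a * e = c *s e"
  using assms by (auto simp: split_family_def)

lemma idem_absorb: "e * e = e \<Longrightarrow> e * (e * u) = e * u" for e :: 'r
  by (metis mult.assoc)

text \<open>With \<open>u = e a g\<close> and \<open>b = g r e\<close>, one-dimensionality of the
  corners makes \<open>u b\<close> and \<open>b u\<close> scalar multiples of \<open>e\<close> and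
  \<open>g\<close>. Evaluating \<open>u b u\<close> in both ways shows that the scalars agree, and
  semiprimeness that they are nonzero.\<close>

lemma corner_inverse:
  assumes A: "subalg A" and E: "split_family A E" and S: "corner_semiprime A E"
    and e: "e \<in> E" and g: "g \<in> E" and a: "a \<in> A" and nz: "e * a * g \<noteq> 0"
  obtains b where "b \<in> A" "g * b * e = b" "e * a * g * b = e" "b * (e * a * g) = g"
proof -
  note eD = split_familyD[OF E e] and gD = split_familyD[OF E g]
  let ?u = "e * a * g"
  obtain r where r: "r \<in> A" "?u * r * ?u \<noteq> 0"
    using S e g a nz unfolding corner_semiprime_def by blast
  define b where "b = g * r * e"
  have bA: "b \<in> A" and uA: "?u \<in> A"
    unfolding b_def using eD(1) gD(1) r a by (auto intro!: subalg_mult[OF A])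
  obtain k where k: "e * (a * g * g * r) * e = k *s e"
    using eD(5)[of "a * g * g * r"] a r gD(1) by (auto intro!: subalg_mult[OF A])
  obtain l where l: "g * (r * e * e * a) * g = l *s g"
    using gD(5)[of "r * e * e * a"] a r eD(1) by (auto intro!: subalg_mult[OF A])
  have ub: "?u * b = k *s e" using k by (simp add: b_def mult.assoc)
  have bu: "b * ?u = l *s g" using l by (simp add: b_def mult.assoc)
  have ge: "g * b * e = b" by (simp add: b_def mult.assoc eD(3) gD(3) idem_absorb)
  have ue: "e * ?u = ?u" "?u * g = ?u" by (simp_all add: mult.assoc eD(3) gD(3) idem_absorb)
  have "?u * b * ?u \<noteq> 0" using r(2) by (simp add: b_def mult.assoc eD(3) gD(3) idem_absorb)
  moreover have ubu: "?u * b * ?u = k *s ?u" "?u * b * ?u = l *s ?u"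
  proof -
    show "?u * b * ?u = k *s ?u" unfolding ub scale_mult_left ue(1) ..
    show "?u * b * ?u = l *s ?u" unfolding mult.assoc[of ?u b ?u] bu scale_mult_right ue(2) ..
  qed
  ultimately have kl: "k \<noteq> 0" "l = k" using nz by auto
  show thesis
  proof (rule that[of "inverse k *s b"])
    show "inverse k *s b \<in> A" by (rule subalg_scale[OF A bA])
  qed (use ub bu ge kl in \<open>simp_all add: mult.assoc\<close>)
qed

lemma corner_mult_nonzero:
  assumes A: "subalg A" and E: "split_family A E" and S: "corner_semiprime A E"
    and e: "e \<in> E" and g: "g \<in> E" and a: "a \<in> A"
    and nz: "e * a * g \<noteq> 0" and nz': "g * b \<noteq> 0"
  shows "e * a * g * b \<noteq> 0"
proof
  assume 0: "e * a * g * b = 0"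
  obtain r where r: "r * (e * a * g) = g" by (rule corner_inverse[OF A E S e g a nz])
  have "g * b = r * (e * a * g * b)" using r by (simp add: mult.assoc[symmetric])
  with 0 nz' show False by simp
qed

text \<open>Each class of linked idempotents becomes one matrix block whose size is the number of
  its members; invertible elements joining the members to a chosen one, numbered 0, provide the
  matrix units.\<close>

lemma split_family_imp_matrix_product:
  assumes A: "subalg A" and E: "split_family A E" and S: "corner_semiprime A E"
    and unit: "\<And>a. a \<in> A \<Longrightarrow> \<Sum>E * a = a" "\<And>a. a \<in> A \<Longrightarrow> a * \<Sum>E = a"
  shows "\<exists>k d (\<phi> :: 'r \<Rightarrow> nat \<Rightarrow> nat \<Rightarrow> nat \<Rightarrow> 'a).
      (\<forall>i<k. d i \<ge> 1) \<and> bij_betw \<phi> A (MP_carrier k d) \<and>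
      (\<forall>u\<in>A. \<forall>v\<in>A. \<phi> (u + v) = (\<lambda>i r s. \<phi> u i r s + \<phi> v i r s)) \<and>
      (\<forall>c. \<forall>u\<in>A. \<phi> (c *s u) = (\<lambda>i r s. c * \<phi> u i r s)) \<and>
      (\<forall>u\<in>A. \<forall>v\<in>A. \<phi> (u * v) = MP_mult k d (\<phi> u) (\<phi> v))"
proof -
  have fin: "finite E" using E by (simp add: split_family_def)
  note ED = split_familyD[OF E]
  \<comment> \<open>Linkage of idempotents, that is, isomorphism of the left ideals they generate.
    Symmetry and transitivity come from inverting nonzero elements of \<open>e A g\<close>.\<close>
  define R where "R = {(e, g). e \<in> E \<and> g \<in> E \<and> (\<exists>a\<in>A. e * a * g \<noteq> 0)}"
  have "equiv E R"
  proof (rule equivI)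
    show "R \<subseteq> E \<times> E" by (auto simp: R_def)
    show "refl_on E R"
    proof (rule refl_onI)
      fix e assume "e \<in> E"
      then have "e \<in> A" "e * e * e \<noteq> 0" using ED(1,2,3) by auto
      then show "(e, e) \<in> R" using \<open>e \<in> E\<close> by (auto simp: R_def)
    qed
    show "sym R"
    proof (rule symI)
      fix e g assume "(e, g) \<in> R"
      then obtain a where a: "e \<in> E" "g \<in> E" "a \<in> A" "e * a * g \<noteq> 0" by (auto simp: R_def)
      obtain b where "b \<in> A" "g * b * e = b" "e * a * g * b = e"
        by (rule corner_inverse[OF A E S a])
      moreover from this have "b \<noteq> 0" using ED(2)[OF a(1)] by auto
      ultimately show "(g, e) \<in> R" using a by (auto simp: R_def intro!: bexI[of _ b])
    qed
    show "trans R"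
    proof (rule transI)
      fix e g h assume "(e, g) \<in> R" "(g, h) \<in> R"
      then obtain a b where ab: "e \<in> E" "g \<in> E" "a \<in> A" "e * a * g \<noteq> 0"
        "h \<in> E" "b \<in> A" "g * b * h \<noteq> 0" by (auto simp: R_def)
      have "e * a * g * (b * h) \<noteq> 0"
        by (rule corner_mult_nonzero[OF A E S ab(1-4)]) (use ab in \<open>simp add: mult.assoc\<close>)
      then have "e * (a * g * b) * h \<noteq> 0" by (simp add: mult.assoc)
      moreover have "a * g * b \<in> A" using ab ED by (auto intro!: subalg_mult[OF A])
      ultimately show "(e, h) \<in> R" using ab by (auto simp: R_def)
    qed
  qed
  note eqR = this
  define k where "k = card (E // R)"
  have finQ: "finite (E // R)" using fin eqR by (simp add: finite_quotient equiv_type)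
  obtain cl where cl: "bij_betw cl {..<k} (E // R)"
    using ex_bij_betw_nat_finite[OF finQ] by (auto simp: k_def atLeast0LessThan)
  define d where "d i = card (cl i)" for i
  have clQ: "cl i \<in> E // R" if "i < k" for i using cl that by (auto simp: bij_betw_def)
  have clE: "cl i \<subseteq> E" if "i < k" for i
    using clQ[OF that] eqR by (meson in_quotient_imp_subset)
  have fincl: "finite (cl i)" if "i < k" for i using clE[OF that] fin finite_subset by blast
  have "\<forall>i. \<exists>f. i < k \<longrightarrow> bij_betw f {..<d i} (cl i)"
    using ex_bij_betw_nat_finite[OF fincl] by (metis d_def atLeast0LessThan)
  then obtain en where en: "\<And>i. i < k \<Longrightarrow> bij_betw (en i) {..<d i} (cl i)" by metis
  have enE: "en i r \<in> E" if "i < k" "r < d i" for i r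
    using en[OF that(1)] clE[OF that(1)] that(2) by (auto simp: bij_betw_def)
  have d1: "d i \<ge> 1" if "i < k" for i
    using clQ[OF that] eqR fincl[OF that] unfolding d_def
    by (metis One_nat_def Suc_leI card_gt_0_iff in_quotient_imp_non_empty)
  have en_ex: "\<exists>i<k. \<exists>r<d i. e = en i r" if "e \<in> E" for e
  proof -
    have "R `` {e} \<in> E // R" using that by (rule quotientI)
    then obtain i where i: "i < k" "cl i = R `` {e}" using cl unfolding bij_betw_def by (metis imageE lessThan_iff)
    have "e \<in> cl i" unfolding i using eqR that by (rule equiv_class_self)
    then show ?thesis using en[OF i(1)] i(1) unfolding bij_betw_def by (metis imageE lessThan_iff)
  qed
  have en_R: "(en i r, en j s) \<in> R \<longleftrightarrow> i = j" if "i < k" "r < d i" "j < k" "s < d j" for i r j s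
  proof -
    have "en i r \<in> cl i" "en j s \<in> cl j" using en that by (auto simp: bij_betw_def)
    then have "(en i r, en j s) \<in> R \<longleftrightarrow> cl i = cl j"
      using quotient_eq_iff[OF eqR clQ[OF that(1)] clQ[OF that(3)]] by blast
    also have "\<dots> \<longleftrightarrow> i = j" using cl that by (auto simp: bij_betw_def inj_on_def)
    finally show ?thesis .
  qed
  have en_inj: "en i r = en i s \<longleftrightarrow> r = s" if "i < k" "r < d i" "s < d i" for i r s
    using en[OF that(1)] that by (auto simp: bij_betw_def inj_on_def)
  \<comment> \<open>\<open>u i r\<close> and \<open>v i r\<close> are the matrix units
    \<open>E_r0\<close> and \<open>E_0r\<close> of block \<open>i\<close>, so that
    \<open>u i r * v i s\<close> is \<open>E_rs\<close>.\<close>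
  have "\<forall>i r. \<exists>u v. i < k \<and> r < d i \<longrightarrow> u \<in> A \<and> v \<in> A \<and> en i r * u = u \<and> u * en i 0 = u \<and>
      en i 0 * v = v \<and> v * en i r = v \<and> u * v = en i r \<and> v * u = en i 0"
  proof (intro allI)
    fix i r
    show "\<exists>u v. i < k \<and> r < d i \<longrightarrow> u \<in> A \<and> v \<in> A \<and> en i r * u = u \<and> u * en i 0 = u \<and>
      en i 0 * v = v \<and> v * en i r = v \<and> u * v = en i r \<and> v * u = en i 0"
    proof (cases "i < k \<and> r < d i")
      case True
      then have i: "i < k" "r < d i" "0 < d i" by auto
      obtain a where a: "a \<in> A" "en i r * a * en i 0 \<noteq> 0"
        using en_R[of i r i 0] i by (auto simp: R_def)
      note E1 = enE[OF i(1,2)] and E0 = enE[OF i(1,3)]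
      obtain b where b: "b \<in> A" "en i 0 * b * en i r = b" "en i r * a * en i 0 * b = en i r"
          "b * (en i r * a * en i 0) = en i 0"
        by (rule corner_inverse[OF A E S E1 E0 a])
      have "en i 0 * b = b" "b * en i r = b"
        using b(2) ED(3)[OF E1] ED(3)[OF E0] by (metis mult.assoc)+
      moreover have "en i r * a * en i 0 \<in> A"
        using a ED(1)[OF E1] ED(1)[OF E0] by (auto intro!: subalg_mult[OF A])
      ultimately show ?thesis using b ED(3)[OF E1] ED(3)[OF E0]
        by (intro exI[of _ "en i r * a * en i 0"] exI[of _ b])
          (simp add: mult.assoc idem_absorb)
    qed auto
  qed
  then obtain u v where uv: "\<And>i r. i < k \<Longrightarrow> r < d i \<Longrightarrow> u i r \<in> A \<and> v i r \<in> A \<and>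
      en i r * u i r = u i r \<and> u i r * en i 0 = u i r \<and> en i 0 * v i r = v i r \<and>
      v i r * en i r = v i r \<and> u i r * v i r = en i r \<and> v i r * u i r = en i 0"
    by metis
  have vu: "v i r * u j s = (if i = j \<and> r = s then en i 0 else 0)"
    if "i < k" "r < d i" "j < k" "s < d j" for i r j s
  proof -
    have "v i r * u j s = v i r * (en i r * en j s) * u j s"
      using uv[OF that(1,2)] uv[OF that(3,4)] by (metis mult.assoc)
    moreover have "en i r * en j s = 0" if "\<not> (i = j \<and> r = s)"
    proof (cases "i = j")
      case True
      then show ?thesis using that en_inj[of i r s] \<open>i < k\<close> \<open>r < d i\<close> \<open>s < d j\<close>
        ED(4)[OF enE enE, of i r j s] by auto
    next
      case False
      have "en i r \<noteq> en j s"
        using en_R[OF \<open>i < k\<close> \<open>r < d i\<close> \<open>j < k\<close> \<open>s < d j\<close>]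
          en_R[OF \<open>i < k\<close> \<open>r < d i\<close> \<open>i < k\<close> \<open>r < d i\<close>] False by metis
      then show ?thesis
        using ED(4)[OF enE enE] \<open>i < k\<close> \<open>r < d i\<close> \<open>j < k\<close> \<open>s < d j\<close> by blast
    qed
    ultimately show ?thesis using uv[OF that(1,2)] by auto
  qed
  have co: "\<exists>c. v i r * a * u i s = c *s en i 0" if "i < k" "r < d i" "s < d i" "a \<in> A" for i r s a
  proof -
    have "en i 0 \<in> E" using that by (intro enE) auto
    moreover have "v i r * a * u i s \<in> A" using uv that by (auto intro!: subalg_mult[OF A])
    ultimately obtain c where "en i 0 * (v i r * a * u i s) * en i 0 = c *s en i 0" using ED(5) by blast
    then show ?thesis using uv[OF that(1,2)] uv[OF that(1,3)] by (metis mult.assoc)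
  qed
  \<comment> \<open>The (r, s) entry is read off in the one-dimensional corner of member 0; the
    value 0 out of range is what \<open>MP_carrier\<close> prescribes.\<close>
  define \<phi> where "\<phi> a i r s = (if i < k \<and> r < d i \<and> s < d i
     then SOME c. v i r * a * u i s = c *s en i 0 else 0)" for a i r s
  have phi: "v i r * a * u i s = \<phi> a i r s *s en i 0" if "i < k" "r < d i" "s < d i" "a \<in> A" for i r s a
    using someI_ex[OF co[OF that]] that by (simp add: \<phi>_def)
  have en0: "en i 0 \<noteq> 0" if "i < k" for i using ED(2)[OF enE[of i 0]] d1[OF that] that by auto
  have phiI: "\<phi> a i r s = c" if "i < k" "r < d i" "s < d i" "a \<in> A" "v i r * a * u i s = c *s en i 0" for i r s a c
    using phi[OF that(1-4)] that(5) en0[OF that(1)] by simp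
  have phi0: "\<phi> a i r s = 0" if "\<not> (i < k \<and> r < d i \<and> s < d i)" for a i r s
    using that by (auto simp: \<phi>_def)
  have sumE: "\<Sum>E = (\<Sum>i<k. \<Sum>r<d i. en i r)"
  proof -
    have "bij_betw (\<lambda>(i, r). en i r) (SIGMA i:{..<k}. {..<d i}) E"
      unfolding bij_betw_def
    proof
      show "inj_on (\<lambda>(i, r). en i r) (SIGMA i:{..<k}. {..<d i})"
      proof (rule inj_onI, clarsimp)
        fix i r j s assume h: "i < k" "r < d i" "j < k" "s < d j" "en i r = en j s"
        then have "i = j" using en_R[of i r i r] en_R[of i r j s] by simp
        then show "i = j \<and> r = s" using h en_inj by auto
      qed
    qed (use enE en_ex in fastforce)
    from sum.reindex_bij_betw[OF this, of "\<lambda>x. x"] show ?thesis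
      by (simp add: sum.Sigma split_def)
  qed
  have add: "\<phi> (a + b) i r s = \<phi> a i r s + \<phi> b i r s" if "a \<in> A" "b \<in> A" for a b i r s
  proof (cases "i < k \<and> r < d i \<and> s < d i")
    case True
    then show ?thesis using that phi[of i r s a] phi[of i r s b]
      by (intro phiI subalg_add[OF A]) (auto simp: algebra_simps scale_left_distrib)
  qed (auto simp: phi0)
  have scal: "\<phi> (c *s a) i r s = c * \<phi> a i r s" if "a \<in> A" for a c i r s
  proof (cases "i < k \<and> r < d i \<and> s < d i")
    case True
    then show ?thesis using that phi[of i r s a]
      by (intro phiI subalg_scale[OF A]) (auto simp: algebra_simps)
  qed (auto simp: phi0)
  \<comment> \<open>Within a block \<open>en i t\<close> factors through member 0 and an entry of
    \<open>a\<close> splits off; between blocks there is no link. Summed over the family, this is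
    the rule for matrix products.\<close>
  have cross: "v i r * a * en j t * b = (if i = j then \<phi> a i r t *s v i t * b else 0)"
    if "i < k" "r < d i" "j < k" "t < d j" "a \<in> A" for i r j t a b
  proof (cases "i = j")
    case True
    have "v i r * a * en i t = v i r * a * u i t * v i t"
      using uv[of i t] that True by (simp add: mult.assoc)
    also have "\<dots> = \<phi> a i r t *s v i t"
      using phi[of i r t a] uv[of i t] that True by simp
    finally show ?thesis using True by simp
  next
    case False
    then have "en i r * a * en j t = 0"
      using en_R[OF that(1-4)] that enE by (auto simp: R_def)
    then have "v i r * en i r * a * en j t = 0" by (simp add: mult.assoc)
    then have "v i r * a * en j t = 0" using uv[of i r] that by simp
    then show ?thesis using False by simp
  qed
  have mul: "\<phi> (a * b) = MP_mult k d (\<phi> a) (\<phi> b)" if "a \<in> A" "b \<in> A" for a b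
  proof (intro ext)
    fix i r s
    show "\<phi> (a * b) i r s = MP_mult k d (\<phi> a) (\<phi> b) i r s"
    proof (cases "i < k \<and> r < d i \<and> s < d i")
      case True
      then have "v i r * (a * b) * u i s = v i r * (a * \<Sum>E) * b * u i s"
        using unit(2)[OF that(1)] by (simp add: mult.assoc)
      also have "\<dots> = (\<Sum>j<k. \<Sum>t<d j. v i r * a * en j t * (b * u i s))"
        by (simp add: sumE sum_distrib_left sum_distrib_right mult.assoc)
      also have "\<dots> = (\<Sum>j<k. if j = i then (\<Sum>t<d i. (\<phi> a i r t * \<phi> b i t s) *s en i 0) else 0)"
      proof (intro sum.cong refl)
        fix j assume "j \<in> {..<k}"
        then show "(\<Sum>t<d j. v i r * a * en j t * (b * u i s)) =
           (if j = i then (\<Sum>t<d i. (\<phi> a i r t * \<phi> b i t s) *s en i 0) else 0)"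
          using True that cross[of i r j _ a "b * u i s"] phi[of i _ s b]
          by (auto simp: mult.assoc[symmetric] intro!: sum.cong sum.neutral)
      qed
      also have "\<dots> = (\<Sum>t<d i. \<phi> a i r t * \<phi> b i t s) *s en i 0"
        using True by (simp add: scale_sum_left)
      finally show ?thesis using True that
        by (auto simp: MP_mult_def intro!: phiI subalg_mult[OF A])
    qed (auto simp: phi0 MP_mult_def)
  qed
  have "inj_on \<phi> A"
  proof (rule inj_onI)
    fix a b assume ab: "a \<in> A" "b \<in> A" "\<phi> a = \<phi> b"
    define z where "z = a - b"
    have zA: "z \<in> A" unfolding z_def using ab by (intro subalg_diff[OF A])
    have vz: "v i r * z * en j t * 1 = 0" if "i < k" "r < d i" "j < k" "t < d j" for i r j t
    proof -
      have "\<phi> a = (\<lambda>i r s. \<phi> z i r s + \<phi> b i r s)"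
        using add[OF zA ab(2)] by (intro ext) (simp add: z_def)
      then have "\<phi> z i r s = 0" for i r s using ab(3) by (metis add_cancel_right_left)
      then show ?thesis using cross[OF that zA, of 1] by simp
    qed
    have "en i r * z * en j t = 0" if "i < k" "r < d i" "j < k" "t < d j" for i r j t
    proof -
      have "en i r * z * en j t = u i r * (v i r * z * en j t)"
        using uv[OF that(1,2)] by (simp add: mult.assoc[symmetric])
      then show ?thesis using vz[OF that] by simp
    qed
    then have "\<Sum>E * z * \<Sum>E = 0"
      by (simp add: sumE sum_distrib_left sum_distrib_right)
    then show "a = b" using unit[OF zA] by (simp add: z_def)
  qed
  moreover have "\<phi> ` A = MP_carrier k d"
  proof
    show "\<phi> ` A \<subseteq> MP_carrier k d" by (auto simp: MP_carrier_def phi0)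
    show "MP_carrier k d \<subseteq> \<phi> ` A"
    proof
      fix M :: "nat \<Rightarrow> nat \<Rightarrow> nat \<Rightarrow> 'a" assume M: "M \<in> MP_carrier k d"
      define a where "a = (\<Sum>i<k. \<Sum>r<d i. \<Sum>s<d i. M i r s *s (u i r * v i s))"
      have aA: "a \<in> A" unfolding a_def using uv
        by (auto intro!: subalg_sum[OF A] subalg_scale[OF A] subalg_mult[OF A])
      have "\<phi> a i r s = M i r s" for i r s
      proof (cases "i < k \<and> r < d i \<and> s < d i")
        case True
        have "v i r * a * u i s =
           (\<Sum>j<k. \<Sum>r'<d j. \<Sum>s'<d j. M j r' s' *s ((v i r * u j r') * (v j s' * u i s)))"
          by (simp add: a_def sum_distrib_left sum_distrib_right mult.assoc)
        also have "\<dots> = (\<Sum>j<k. \<Sum>r'<d j. \<Sum>s'<d j.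
            if j = i then if r' = r then if s' = s then M i r s *s en i 0 else 0 else 0 else 0)"
          using True vu ED(3)[OF enE[of i 0]] by (intro sum.cong refl) auto
        also have "\<dots> = (\<Sum>j<k. \<Sum>r'<d j. if j = i then if r' = r then M i r s *s en i 0 else 0 else 0)"
          using True by (intro sum.cong refl) auto
        also have "\<dots> = (\<Sum>j<k. if j = i then M i r s *s en i 0 else 0)"
          using True by (intro sum.cong refl) auto
        also have "\<dots> = M i r s *s en i 0" using True by simp
        finally show ?thesis using True aA by (auto intro!: phiI)
      next
        case False
        then show ?thesis using M by (simp add: phi0 MP_carrier_def)
      qed
      then have "\<phi> a = M" by (intro ext)
      then show "M \<in> \<phi> ` A" using aA by blast
    qed
  qed
  ultimately have "bij_betw \<phi> A (MP_carrier k d)" by (simp add: bij_betw_def)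
  then show ?thesis using d1 add scal mul
    by (intro exI[of _ k] exI[of _ d] exI[of _ \<phi>]) (auto simp: fun_eq_iff)
qed

end

section \<open>Eigenspace decomposition of an idempotent\<close>

context field_algebra
begin

text \<open>A polynomial that splits over the field, given by its roots with multiplicity and
  evaluated at \<open>Y\<close>.\<close>

definition root_prod :: "'a list \<Rightarrow> 'r \<Rightarrow> 'r" where
  "root_prod cs Y = prod_list (map (\<lambda>c. Y - c *s 1) cs)"

lemma root_prod_simps [simp]:
  "root_prod [] Y = 1" "root_prod (c # cs) Y = (Y - c *s 1) * root_prod cs Y"
  by (simp_all add: root_prod_def)

lemma root_prod_append: "root_prod (cs @ ds) Y = root_prod cs Y * root_prod ds Y"
  by (simp add: root_prod_def)

lemma root_prod_intertwine:
  assumes "p * X = Y * p"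
  shows "p * root_prod cs X = root_prod cs Y * p"
proof (induction cs)
  case (Cons c cs)
  have "p * root_prod (c # cs) X = (p * (X - c *s 1)) * root_prod cs X" by (simp add: mult.assoc)
  also have "p * (X - c *s 1) = (Y - c *s 1) * p" using assms by (simp add: algebra_simps)
  finally show ?case using Cons by (simp add: mult.assoc)
qed simp

lemma root_prod_eigen:
  assumes "Y * v = c *s v"
  shows "root_prod cs Y * v = prod_list (map (\<lambda>d. c - d) cs) *s v"
proof (induction cs)
  case (Cons d cs)
  then have "root_prod (d # cs) Y * v = prod_list (map (\<lambda>d. c - d) cs) *s ((Y - d *s 1) * v)"
    by (simp add: mult.assoc)
  also have "(Y - d *s 1) * v = (c - d) *s v" using assms by (simp add: algebra_simps)
  finally show ?case by (simp add: mult.commute)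
qed simp

lemma root_prod_factor:
  assumes "c \<in> set cs"
  shows "\<exists>W. root_prod cs Y = (Y - c *s 1) * W"
  using assms
proof (induction cs)
  case (Cons d cs)
  show ?case
  proof (cases "c = d")
    case False
    then obtain W where W: "root_prod cs Y = (Y - c *s 1) * W" using Cons by auto
    have "root_prod (d # cs) Y = (Y - d *s 1) * (Y - c *s 1) * W" using W by (simp add: mult.assoc)
    also have "(Y - d *s 1) * (Y - c *s 1) = (Y - c *s 1) * (Y - d *s 1)"
      by (simp add: algebra_simps)
    finally show ?thesis by (auto simp: mult.assoc)
  qed auto
qed simp

text \<open>A resolution of \<open>z\<close> into eigenprojections of \<open>Y\<close>. Only the
  left action is prescribed; the right one follows once \<open>K\<close> commutes with
  \<open>Y\<close>.\<close>

definition eigen_family :: "'r set \<Rightarrow> 'r \<Rightarrow> 'r \<Rightarrow> 'r set \<Rightarrow> bool" where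
  "eigen_family K Y z H \<longleftrightarrow> finite H \<and> H \<subseteq> K \<and> 0 \<notin> H \<and> (\<forall>h\<in>H. h * h = h) \<and>
     (\<forall>h\<in>H. \<forall>g\<in>H. h \<noteq> g \<longrightarrow> h * g = 0) \<and> \<Sum>H = z \<and>
     (\<forall>h\<in>H. z * h = h \<and> h * z = h \<and> (\<exists>d. Y * h = d *s h))"

lemma eigen_family_mono: "eigen_family K Y z H \<Longrightarrow> K \<subseteq> K' \<Longrightarrow> eigen_family K' Y z H"
  unfolding eigen_family_def by blast

lemma eigen_familyD:
  assumes "eigen_family K Y z H"
  shows "finite H" "H \<subseteq> K" "0 \<notin> H" "\<Sum>H = z"
    "\<And>h. h \<in> H \<Longrightarrow> h * h = h" "\<And>h g. h \<in> H \<Longrightarrow> g \<in> H \<Longrightarrow> h \<noteq> g \<Longrightarrow> h * g = 0"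
    "\<And>h. h \<in> H \<Longrightarrow> z * h = h" "\<And>h. h \<in> H \<Longrightarrow> h * z = h"
    "\<And>h. h \<in> H \<Longrightarrow> \<exists>d. Y * h = d *s h"
  using assms unfolding eigen_family_def by simp_all

lemma eigen_decomposition:
  assumes K: "subspace K" "\<And>v. v \<in> K \<Longrightarrow> Y * v \<in> K" "\<And>v. v \<in> K \<Longrightarrow> v * Y = Y * v"
    and reduced: "\<And>v. v \<in> K \<Longrightarrow> v * v = 0 \<Longrightarrow> v = 0"
    and z: "z \<in> K" "z * z = z" "z * root_prod cs Y = 0"
  shows "\<exists>H. eigen_family K Y z H"
  using z
proof (induction cs arbitrary: z)
  case Nil
  then show ?case by (intro exI[of _ "{}"]) (auto simp: eigen_family_def)
next
  case (Cons c cs)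
  let ?P = "root_prod cs Y"
  have comm: "v * ?P = ?P * v" if "v \<in> K" for v
    by (rule root_prod_intertwine) (rule K(3)[OF that])
  have PK: "root_prod ds Y * v \<in> K" if "v \<in> K" for v ds
  proof (induction ds)
    case (Cons d ds)
    have "root_prod (d # ds) Y * v = Y * (root_prod ds Y * v) - d *s (root_prod ds Y * v)"
      by (simp add: algebra_simps)
    then show ?case using Cons K(2)[OF Cons] K(1) by (simp add: subspace_diff subspace_scale)
  qed (use that in simp)
  define v where "v = ?P * z"
  have vK: "v \<in> K" using PK Cons.prems by (simp add: v_def)
  have zY: "(Y - c *s 1) * z = z * (Y - c *s 1)" using K(3)[OF Cons.prems(1)] by (simp add: algebra_simps)
  have v0: "(Y - c *s 1) * v = 0"
  proof -
    have "(Y - c *s 1) * v = ((Y - c *s 1) * z) * ?P"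
      unfolding v_def comm[OF Cons.prems(1), symmetric] by (rule mult.assoc[symmetric])
    also have "\<dots> = z * ((Y - c *s 1) * ?P)" unfolding zY by (rule mult.assoc)
    finally show ?thesis using Cons.prems(3) by simp
  qed
  have zv: "z * v = v" "v * z = v"
  proof -
    show "v * z = v" unfolding v_def mult.assoc Cons.prems(2) ..
    show "z * v = v" unfolding v_def comm[OF Cons.prems(1), symmetric] mult.assoc[symmetric] Cons.prems(2) ..
  qed
  show ?case
  proof (cases "c \<in> set cs")
    case True
    then obtain W where W: "?P = (Y - c *s 1) * W" using root_prod_factor by blast
    \<comment> \<open>One of the two factors \<open>v\<close> is expanded: \<open>P\<close> contains
      \<open>Y - c\<close>, which kills the other one.\<close>
    have "v * v = v * (?P * z)" by (simp add: v_def)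
    also have "\<dots> = (v * (Y - c *s 1)) * W * z" by (simp add: W mult.assoc)
    also have "v * (Y - c *s 1) = (Y - c *s 1) * v" using K(3)[OF vK] by (simp add: algebra_simps)
    finally have "v * v = 0" using v0 by simp
    then have "v = 0" by (rule reduced[OF vK])
    then have "z * ?P = 0" using comm[OF Cons.prems(1)] by (simp add: v_def)
    then show ?thesis by (rule Cons.IH[OF Cons.prems(1,2)])
  next
    case False
    define k where "k = prod_list (map (\<lambda>d. c - d) cs)"
    have k: "k \<noteq> 0" using False by (auto simp: k_def prod_list_zero_iff)
    have Yv: "Y * v = c *s v" using v0 by (simp add: algebra_simps)
    have Pv: "?P * v = k *s v" unfolding k_def by (rule root_prod_eigen[OF Yv])
    \<comment> \<open>Lagrange interpolation: \<open>P\<close> acts on \<open>v\<close> by the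
      nonzero value of the polynomial at \<open>c\<close>, and dividing by it makes \<open>v\<close>
      idempotent.\<close>
    define p where "p = inverse k *s v"
    have pK: "p \<in> K" unfolding p_def by (rule subspace_scale[OF K(1) vK])
    have "v * v = ?P * (z * v)" by (simp add: v_def mult.assoc)
    then have "v * v = ?P * v" using zv by simp
    then have pp: "p * p = p" using Pv k by (simp add: p_def)
    have zp: "z * p = p" "p * z = p" using zv by (simp_all add: p_def)
    have pY: "Y * p = c *s p" using Yv by (simp add: p_def scale_left_commute)
    have z'P: "(z - p) * ?P = 0"
    proof -
      have "p * ?P = v" using comm[OF vK] Pv k by (simp add: p_def)
      then show ?thesis using comm[OF Cons.prems(1)] by (simp add: v_def left_diff_distrib)
    qed
    have z'z': "(z - p) * (z - p) = z - p" using zp pp Cons.prems(2) by (simp add: algebra_simps)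
    have "z - p \<in> K" using pK Cons.prems(1) K(1) by (simp add: subspace_diff)
    from Cons.IH[OF this z'z' z'P] obtain H where "eigen_family K Y (z - p) H" by blast
    note H = eigen_familyD[OF this]
    have ph: "p * h = 0 \<and> h * p = 0 \<and> z * h = h \<and> h * z = h" if "h \<in> H" for h
    proof -
      have "p * h = p * ((z - p) * h)" using H(7)[OF that] by simp
      also have "\<dots> = (p * (z - p)) * h" by (simp add: mult.assoc)
      also have "\<dots> = 0" using zp pp by (simp add: algebra_simps)
      finally have 1: "p * h = 0" .
      have "h * p = (h * (z - p)) * p" using H(8)[OF that] by simp
      also have "\<dots> = h * ((z - p) * p)" by (simp add: mult.assoc)
      also have "\<dots> = 0" using zp pp by (simp add: algebra_simps)
      finally have 2: "h * p = 0" .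
      have "z * h = (z - p) * h" "h * z = h * (z - p)" using 1 2 by (simp_all add: algebra_simps)
      then show ?thesis using 1 2 H(7,8)[OF that] by metis
    qed
    show ?thesis
    \<comment> \<open>A listed root need not be an eigenvalue; \<open>p\<close> is then 0, which a
      family may not contain.\<close>
    proof (cases "p = 0")
      case True
      then have "\<Sum>H = z" using H(4) by simp
      then have "eigen_family K Y z H" unfolding eigen_family_def
        using H(1-3,5,6,9) ph by (intro conjI ballI impI) blast+
      then show ?thesis by blast
    next
      case False
      then have pH: "p \<notin> H" using ph pp by metis
      then have "\<Sum>(insert p H) = z" using H(1,4) by simp
      moreover have "\<forall>h\<in>insert p H. \<forall>g\<in>insert p H. h \<noteq> g \<longrightarrow> h * g = 0" using H(6) ph by blast
      moreover have "\<forall>h\<in>insert p H. z * h = h \<and> h * z = h \<and> (\<exists>d. Y * h = d *s h)"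
        using H(9) ph zp pY by blast
      moreover have "\<forall>h\<in>insert p H. h * h = h" using H(5) pp by blast
      moreover have "finite (insert p H)" "insert p H \<subseteq> K" "0 \<notin> insert p H"
        using H(1-3) pK False by auto
      ultimately show ?thesis unfolding eigen_family_def by (intro exI[of _ "insert p H"] conjI)
    qed
  qed
qed

end

section \<open>Representations of the symmetric groups\<close>

text \<open>Homomorphic images of the group algebras of all finite symmetric groups, nested in one
  ring with a common unit. Arguments about them run by span induction, never by comparing
  coefficients.\<close>

locale perm_algebra = field_algebra scale
  for scale :: "'a::field_char_0 \<Rightarrow> 'r::ring_1 \<Rightarrow> 'r" (infixr \<open>*s\<close> 75) +
  fixes T :: "(nat \<Rightarrow> nat) \<Rightarrow> 'r"
  assumes T_id: "T id = 1"
    and T_comp: "p permutes {1..n} \<Longrightarrow> q permutes {1..n} \<Longrightarrow> T (p \<circ> q) = T p * T q"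
begin

definition group_alg :: "nat \<Rightarrow> 'r set" where
  "group_alg n = span (T ` {p. p permutes {1..n}})"

lemma T_in [intro]: "p permutes {1..n} \<Longrightarrow> T p \<in> group_alg n"
  unfolding group_alg_def by (auto intro: span_base)

lemma one_in [intro, simp]: "1 \<in> group_alg n"
  using T_in[OF permutes_id] T_id by metis

lemma group_alg_induct [consumes 1, case_names subspace T]:
  assumes "a \<in> group_alg n" "subspace {a. P a}" "\<And>p. p permutes {1..n} \<Longrightarrow> P (T p)"
  shows "P a"
  using assms(1) unfolding group_alg_def by (rule span_induct) (use assms in auto)

lemma subspace_mult_left: "subspace V \<Longrightarrow> subspace {a. u * a \<in> V}"
  by (auto simp: subspace_def algebra_simps)

lemma subspace_mult_right: "subspace V \<Longrightarrow> subspace {a. a * u \<in> V}"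
  by (auto simp: subspace_def algebra_simps)

lemma subspace_commutant: "subspace {a. a * u = u * a}"
  by (auto simp: subspace_def algebra_simps)

lemma subspace_group_alg: "subspace (group_alg n)"
  by (simp add: group_alg_def)

lemma subalg_group_alg: "subalg (group_alg n)"
  unfolding subalg_def
proof (intro conjI ballI subspace_group_alg)
  fix u v assume u: "u \<in> group_alg n" and v: "v \<in> group_alg n"
  from u show "u * v \<in> group_alg n"
  proof (induction rule: group_alg_induct)
    case (T p)
    from v show ?case
    proof (induction rule: group_alg_induct)
      case (T q)
      then have "T p * T q = T (p \<circ> q)" using T_comp[of p n q] \<open>p permutes _\<close> by simp
      then show ?case using T \<open>p permutes _\<close> by (simp add: T_in permutes_compose)
    qed (rule subspace_mult_left[OF subspace_group_alg])
  qed (rule subspace_mult_right[OF subspace_group_alg])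
qed

lemma group_alg_mono: "m \<le> n \<Longrightarrow> group_alg m \<subseteq> group_alg n"
  unfolding group_alg_def
  by (intro span_mono image_mono) (auto intro: permutes_subset)

lemma T_inv: "p permutes {1..n} \<Longrightarrow> T (inv p) * T p = 1" "p permutes {1..n} \<Longrightarrow> T p * T (inv p) = 1"
  using T_comp[of "inv p" n p] T_comp[of p n "inv p"]
  by (simp_all add: permutes_inv permutes_inv_o T_id)

text \<open>Maschke's averaging argument: the left ideal generated by \<open>a\<close> has an averaged complement and
  hence a right unit, so it cannot square to zero.\<close>

lemma group_alg_semiprime:
  assumes z: "z * z = z" "\<And>p. p permutes {1..n} \<Longrightarrow> z * T p = T p * z"
    and \<alpha>: "\<alpha> \<in> group_alg n" and a: "a = z * \<alpha>"
    and nil: "\<And>b. b \<in> group_alg n \<Longrightarrow> a * b * a = 0"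
  shows "a = 0"
proof -
  let ?G = "{p. p permutes {1..n}}"
  define I where "I = (\<lambda>b. b * a) ` group_alg n"
  have zcomm: "z * b = b * z" if "b \<in> group_alg n" for b
  proof -
    from that have "b * z = z * b"
      by (induction rule: group_alg_induct) (use z in \<open>auto intro: subspace_commutant\<close>)
    then show ?thesis by simp
  qed
  have subI: "subspace I"
    using subspace_group_alg[of n] unfolding I_def subspace_def
    by (auto simp: image_iff) (metis mult_zero_left, metis distrib_right, metis scale_mult_left)
  interpret vp: vector_space_pair scale scale by unfold_locales
  obtain \<pi> where \<pi>: "\<pi> ` UNIV \<subseteq> I" "Vector_Spaces.linear (*s) (*s) \<pi>" "\<And>v. v \<in> I \<Longrightarrow> \<pi> v = v"
    using vp.linear_exists_left_inverse_on[OF linear_ident subI] by auto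
  interpret \<pi>: Vector_Spaces.linear scale scale \<pi> by (rule \<pi>(2))
  \<comment> \<open>The unnormalised average of the conjugates of the projection
    \<open>\<pi>\<close>, applied to \<open>z\<close>.\<close>
  define e where "e = (\<Sum>g\<in>?G. T g * \<pi> (T (inv g) * z))"
  have IT: "b * v \<in> I" if "b \<in> group_alg n" "v \<in> I" for b v
    using that subalg_mult[OF subalg_group_alg, of b n] unfolding I_def
    by (auto simp: image_iff) (metis mult.assoc)
  have eI: "e \<in> I"
    unfolding e_def using \<pi>(1) by (intro subspace_sum[OF subI] IT T_in) auto
  \<comment> \<open>\<open>z\<close> is a left unit on the ideal. Taking \<open>z = 1\<close> treats
    the group algebra itself, and \<open>z = moebius {1..k}\<close> a corner of the rook
    algebra.\<close>
  have zI: "z * v = v" if "v \<in> I" for v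
  proof -
    obtain b where b: "b \<in> group_alg n" "v = b * a" using \<open>v \<in> I\<close> by (auto simp: I_def)
    have "z * v = b * (z * a)" using zcomm[OF b(1)] b by (simp add: mult.assoc[symmetric])
    then show ?thesis using b a z(1) by (simp add: mult.assoc[symmetric])
  qed
  have aI: "a \<in> I" using one_in[of n] by (force simp: I_def)
  \<comment> \<open>Translating the summation index carries \<open>\<alpha>\<close> inside
    \<open>\<pi>\<close>; after absorbing \<open>z\<close>, the argument of \<open>\<pi>\<close>
    lies in the ideal, where \<open>\<pi>\<close> is the identity.\<close>
  have avg: "\<alpha> * e = (\<Sum>g\<in>?G. T g * \<pi> (T (inv g) * \<alpha> * z))"
    using \<alpha>
  proof (induction rule: group_alg_induct)
    case subspace
    show ?case
      by (auto simp: subspace_def distrib_left distrib_right sum.distrib \<pi>.add \<pi>.scale \<pi>.zero scale_sum_right)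
  next
    case (T h)
    have "T h * e = (\<Sum>g\<in>?G. T (h \<circ> g) * \<pi> (T (inv g) * z))"
      using T by (auto simp: e_def sum_distrib_left T_comp mult.assoc intro!: sum.cong)
    also have "\<dots> = (\<Sum>g\<in>?G. T g * \<pi> (T (inv g) * T h * z))"
    proof (rule sum.reindex_bij_witness[where i = "\<lambda>g. inv h \<circ> g" and j = "\<lambda>g. h \<circ> g"])
      fix g assume "g \<in> ?G"
      then have g: "g permutes {1..n}" by simp
      have "inv (h \<circ> g) \<circ> h = inv g"
        using g T by (simp add: o_inv_distrib permutes_bij o_assoc[symmetric] permutes_inv_o)
      then show "T (h \<circ> g) * \<pi> (T (inv (h \<circ> g)) * T h * z) = T (h \<circ> g) * \<pi> (T (inv g) * z)"
        using T g T_comp[of "inv (h \<circ> g)" n h] by (simp add: permutes_inv permutes_compose)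
    qed (use T in \<open>auto simp: o_assoc permutes_inv_o permutes_compose permutes_inv\<close>)
    finally show ?case .
  qed
  have "a * e = \<alpha> * (z * e)" using zcomm[OF \<alpha>] a by (simp add: mult.assoc)
  also have "\<dots> = \<alpha> * e" using zI[OF eI] by simp
  also have "\<dots> = (\<Sum>g\<in>?G. T g * \<pi> (T (inv g) * a))"
    unfolding avg using zcomm[OF \<alpha>] a by (simp add: mult.assoc)
  also have "\<dots> = (\<Sum>g\<in>?G. a)"
  proof (rule sum.cong[OF refl])
    fix g assume "g \<in> ?G"
    then have g: "g permutes {1..n}" by simp
    have "T (inv g) * a \<in> I" using g aI by (intro IT T_in permutes_inv)
    then show "T g * \<pi> (T (inv g) * a) = a"
      using T_inv(2)[OF g] by (simp add: \<pi>(3) mult.assoc[symmetric])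
  qed
  also have "\<dots> = of_nat (card ?G) *s a"
    by (rule sum_constant_scale)
  finally have "a * e = of_nat (card ?G) *s a" .
  moreover obtain b where "b \<in> group_alg n" "e = b * a" using eI by (auto simp: I_def)
  then have "a * e = 0" using nil by (simp add: mult.assoc)
  \<comment> \<open>In characteristic zero this makes the scalar in front of \<open>a\<close>
    invertible.\<close>
  moreover have "card ?G \<noteq> 0"
    by (simp add: card_permutations)
  ultimately show ?thesis by (metis of_nat_eq_0_iff scale_eq_0_iff)
qed

end

section \<open>Jucys-Murphy elements\<close>

context perm_algebra
begin

text \<open>The Jucys-Murphy element usually numbered \<open>m + 1\<close>; the shift makes
  \<open>jm m\<close> the one that commutes with \<open>group_alg m\<close>.\<close>

definition jm :: "nat \<Rightarrow> 'r" where
  "jm m = (\<Sum>i\<in>{1..m}. T (transpose i (Suc m)))"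

text \<open>The adjacent transposition that leads from \<open>group_alg (Suc m)\<close> to the next
  level while commuting with \<open>group_alg m\<close>.\<close>

definition sw :: "nat \<Rightarrow> 'r" where
  "sw m = T (transpose (Suc m) (Suc (Suc m)))"

lemma permutes_transpose_Icc: "1 \<le> i \<Longrightarrow> 1 \<le> j \<Longrightarrow> i \<le> n \<Longrightarrow> j \<le> n \<Longrightarrow> transpose i j permutes {1..n}"
  by (rule permutes_swap_id) auto

lemma jm_in: "jm m \<in> group_alg (Suc m)"
  unfolding jm_def by (intro subalg_sum[OF subalg_group_alg] T_in permutes_transpose_Icc) auto

lemma sw_square: "sw m * sw m = 1"
proof -
  have "transpose (Suc m) (Suc (Suc m)) permutes {1..Suc (Suc m)}" by (rule permutes_transpose_Icc) auto
  from T_comp[OF this this] show ?thesis by (simp add: sw_def T_id)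
qed

lemma T_transpose_conj:
  assumes p: "p permutes {1..n}" and ij: "1 \<le> i" "1 \<le> j" "i \<le> n" "j \<le> n"
  shows "T p * T (transpose i j) = T (transpose (p i) (p j)) * T p"
proof -
  have "p ` {1..n} = {1..n}" using p by (rule permutes_image)
  moreover have "i \<in> {1..n}" "j \<in> {1..n}" using ij by auto
  ultimately have "p i \<in> {1..n}" "p j \<in> {1..n}" by blast+
  then have t: "transpose (p i) (p j) permutes {1..n}" by (rule permutes_swap_id)
  have "p \<circ> transpose i j = transpose (p i) (p j) \<circ> p"
    using p by (simp add: fun_eq_iff transpose_def permutes_inj inj_eq)
  then show ?thesis
    using T_comp[OF p permutes_transpose_Icc[OF ij]] T_comp[OF t p] by simp
qed

lemma sw_commute:
  assumes "a \<in> group_alg m" shows "a * sw m = sw m * a"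
  using assms
proof (induction rule: group_alg_induct)
  case (T p)
  then have "p (Suc m) = Suc m" "p (Suc (Suc m)) = Suc (Suc m)"
    by (auto simp: permutes_not_in)
  moreover have "p permutes {1..Suc (Suc m)}" using T by (rule permutes_subset) auto
  ultimately show ?case
    using T_transpose_conj[of p "Suc (Suc m)" "Suc m" "Suc (Suc m)"] by (simp add: sw_def)
qed (rule subspace_commutant)

text \<open>A permutation of \<open>{1..m}\<close> fixes \<open>Suc m\<close>, so conjugation only
  permutes the transpositions in the sum.\<close>

lemma jm_commute:
  assumes "a \<in> group_alg m" shows "a * jm m = jm m * a"
  using assms
proof (induction rule: group_alg_induct)
  case (T p)
  have p': "p permutes {1..Suc m}" using T by (rule permutes_subset) auto
  have pm: "p (Suc m) = Suc m" using T by (auto simp: permutes_not_in)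
  have "T p * jm m = (\<Sum>i\<in>{1..m}. T (transpose (p i) (Suc m)) * T p)"
    unfolding jm_def sum_distrib_left
    by (intro sum.cong refl) (use T_transpose_conj[OF p', of _ "Suc m"] pm in auto)
  also have "\<dots> = (\<Sum>i\<in>{1..m}. T (transpose i (Suc m)) * T p)"
    using sum.permute[OF T, of "\<lambda>i. T (transpose i (Suc m)) * T p"] by (simp add: o_def)
  finally show ?case by (simp add: jm_def sum_distrib_right)
qed (rule subspace_commutant)

text \<open>Conjugation by \<open>sw m\<close> replaces \<open>Suc m\<close> by the next point in
  each transposition; the only one missed is \<open>sw m\<close> itself.\<close>

lemma jm_Suc: "jm (Suc m) = sw m * jm m * sw m + sw m"
proof -
  let ?t = "transpose (Suc m) (Suc (Suc m))"
  have t: "?t permutes {1..Suc (Suc m)}" by (rule permutes_transpose_Icc) auto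
  have "sw m * T (transpose i (Suc m)) * sw m = T (transpose i (Suc (Suc m)))" if "i \<in> {1..m}" for i
  proof -
    have "sw m * T (transpose i (Suc m)) = T (transpose (?t i) (?t (Suc m))) * sw m"
      unfolding sw_def using that by (intro T_transpose_conj[OF t]) auto
    moreover have "?t i = i" using that by (auto simp: transpose_def)
    ultimately show ?thesis by (simp add: mult.assoc sw_square)
  qed
  then have "sw m * jm m * sw m = (\<Sum>i\<in>{1..m}. T (transpose i (Suc (Suc m))))"
    by (simp add: jm_def sum_distrib_left sum_distrib_right)
  then show ?thesis by (simp add: jm_def sw_def)
qed

text \<open>The symmetric group on \<open>m + 2\<close> points consists of two double cosets of the
  one on \<open>m + 1\<close> points, those of the identity and of the last adjacent
  transposition.\<close>

lemma group_alg_Suc_induct: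
  assumes a: "a \<in> group_alg (Suc (Suc m))" and V: "subspace V" "group_alg (Suc m) \<subseteq> V"
    and W: "\<And>b b'. b \<in> group_alg (Suc m) \<Longrightarrow> b' \<in> group_alg (Suc m) \<Longrightarrow> b * sw m * b' \<in> V"
  shows "a \<in> V"
  using a
proof (induction rule: group_alg_induct)
  case subspace
  then show ?case using V(1) by simp
next
  case (T p)
  let ?n = "Suc m" and ?t = "transpose (Suc m) (Suc (Suc m))"
  have fixlast: "q permutes {1..?n}" if "q permutes {1..Suc ?n}" "q (Suc ?n) = Suc ?n" for q
    using that by (intro permutes_superset[OF that(1)]) (auto simp: le_Suc_eq)
  show ?case
  proof (cases "p (Suc ?n) = Suc ?n")
    case True
    then show ?thesis using fixlast[OF T] V(2) T_in by blast
  next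
    case False
    define j where "j = p (Suc ?n)"
    have "j \<in> {1..Suc ?n}" unfolding j_def using permutes_in_image[OF T] by auto
    then have j: "j \<in> {1..?n}" using False by (auto simp: j_def)
    define b where "b = transpose j ?n"
    have b: "b permutes {1..?n}" unfolding b_def using j by (intro permutes_transpose_Icc) auto
    then have b': "b permutes {1..Suc ?n}" by (rule permutes_subset) auto
    have t: "?t permutes {1..Suc ?n}" by (rule permutes_transpose_Icc) auto
    \<comment> \<open>\<open>b\<close> takes the image \<open>j\<close> of the last point to
      \<open>Suc m\<close> and \<open>?t\<close> brings it back to the last place, so
      \<open>q\<close> belongs to the smaller group.\<close>
    define q where "q = ?t \<circ> (b \<circ> p)"
    have q': "q permutes {1..Suc ?n}" unfolding q_def by (intro permutes_compose T b' t)
    have "q (Suc ?n) = Suc ?n" using j by (simp add: q_def b_def j_def[symmetric])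
    with q' have q: "q permutes {1..?n}" by (rule fixlast)
    have "p = b \<circ> (?t \<circ> q)" by (simp add: q_def b_def fun_eq_iff)
    then have "T p = T b * (sw m * T q)"
      using T_comp[OF b' permutes_compose[OF q' t]] T_comp[OF t q'] by (simp add: sw_def)
    then show ?thesis using W[OF T_in[OF b] T_in[OF q]] by (simp add: mult.assoc)
  qed
qed

section \<open>Refining a Gelfand-Tsetlin family\<close>

text \<open>Two consecutive levels of the Gelfand-Tsetlin idempotents, \<open>C\<close> for
  \<open>m\<close> and \<open>B\<close> for \<open>Suc m\<close>; the relation
  \<open>f * g = g\<close> is the path from one to the other. The last clause is
  multiplicity-freeness of branching: distinct idempotents below the same \<open>f\<close> lie in
  different blocks.\<close>

definition gt_pair :: "nat \<Rightarrow> 'r set \<Rightarrow> 'r set \<Rightarrow> bool" where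
  "gt_pair m C B \<longleftrightarrow>
     C \<subseteq> group_alg m \<and> (\<forall>f\<in>C. \<forall>f'\<in>C. f \<noteq> f' \<longrightarrow> f * f' = 0) \<and>
     (\<forall>f\<in>C. \<exists>cs. f * root_prod cs (jm m) = 0) \<and>
     split_family (group_alg (Suc m)) B \<and> \<Sum>B = 1 \<and>
     (\<forall>g\<in>B. (\<exists>f\<in>C. f * g = g \<and> g * f = g) \<and> (\<exists>c. jm m * g = c *s g \<and> g * jm m = c *s g)) \<and>
     (\<forall>f\<in>C. \<forall>g\<in>B. \<forall>g'\<in>B. g \<noteq> g' \<longrightarrow> f * g = g \<longrightarrow> f * g' = g' \<longrightarrow>
        (\<forall>a\<in>group_alg (Suc m). g * a * g' = 0))"

lemma group_alg_corner_semiprime: "E \<subseteq> group_alg n \<Longrightarrow> corner_semiprime (group_alg n) E"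
  unfolding corner_semiprime_def
proof (intro ballI impI)
  fix e g a assume E: "E \<subseteq> group_alg n" and h: "e \<in> E" "g \<in> E" "a \<in> group_alg n" "e * a * g \<noteq> 0"
  have "e * a * g \<in> group_alg n" using h E by (auto intro!: subalg_mult[OF subalg_group_alg])
  then show "\<exists>b\<in>group_alg n. (e * a * g) * b * (e * a * g) \<noteq> 0"
    using group_alg_semiprime[of 1 n "e * a * g" "e * a * g"] h by auto
qed

text \<open>The relations of the degenerate affine Hecke algebra, read off from
  \<open>jm_Suc\<close> and \<open>sw_square\<close>.\<close>

lemma jm_sw_relations:
  "sw m * jm m = jm (Suc m) * sw m - 1" "sw m * jm (Suc m) = jm m * sw m + 1"
  "jm m * jm (Suc m) = jm (Suc m) * jm m"
proof -
  have "jm (Suc m) * sw m = sw m * jm m * (sw m * sw m) + sw m * sw m"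
    by (simp only: jm_Suc distrib_right mult.assoc)
  then show "sw m * jm m = jm (Suc m) * sw m - 1" by (simp add: sw_square)
  have "sw m * jm (Suc m) = (sw m * sw m) * jm m * sw m + sw m * sw m"
    by (simp only: jm_Suc distrib_left mult.assoc)
  then show "sw m * jm (Suc m) = jm m * sw m + 1" by (simp add: sw_square)
  show "jm m * jm (Suc m) = jm (Suc m) * jm m" by (rule jm_commute[OF jm_in])
qed

text \<open>The intertwiner \<open>s (X - Y) + 1\<close> turns annihilating polynomials of \<open>X\<close> into ones for \<open>Y\<close>,
  since its square is \<open>1 - (X - Y)\<^sup>2\<close>.\<close>

lemma jm_root_prod_Suc:
  assumes f: "f \<in> group_alg m" "f * root_prod cs (jm m) = 0"
    and e: "e * f = e" "e * jm m = c *s e"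
  shows "e * root_prod (cs @ [c + 1, c - 1]) (jm (Suc m)) = 0"
proof -
  let ?s = "sw m" and ?X = "jm m" and ?Y = "jm (Suc m)"
  note rel = jm_sw_relations[of m]
  define D where "D = ?X - ?Y"
  define p where "p = ?s * D + 1"
  have DX: "D * ?X = ?X * D" using rel(3) by (simp add: D_def algebra_simps)
  have Ds: "D * ?s = - (?s * D) - 1 - 1"
  proof -
    have "?Y * ?s = ?s * ?X + 1" "?X * ?s = ?s * ?Y - 1" using rel(1,2) by simp_all
    then show ?thesis by (simp add: D_def left_diff_distrib right_diff_distrib)
  qed
  have pX: "p * ?X = ?Y * p"
  proof -
    have "p * ?X = (?s * ?X) * D + ?X" using DX by (simp add: p_def distrib_right mult.assoc)
    also have "\<dots> = ?Y * (?s * D) - D + ?X" unfolding rel(1) by (simp add: algebra_simps)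
    also have "\<dots> = ?Y * p" by (simp add: p_def D_def algebra_simps)
    finally show ?thesis .
  qed
  have pp: "p * p = 1 - D * D"
  proof -
    have "p * p = ?s * (D * ?s) * D + ?s * D + ?s * D + 1" by (simp add: p_def algebra_simps)
    also have "?s * (D * ?s) * D = - (?s * ?s) * D * D - ?s * D - ?s * D"
      unfolding Ds by (simp only: left_diff_distrib right_diff_distrib mult_minus_left
        mult_minus_right mult_1_left mult_1_right mult.assoc)
    finally show ?thesis by (simp add: sw_square)
  qed
  have fm: "f \<in> group_alg (Suc m)" using f(1) group_alg_mono[of m "Suc m"] by auto
  have fp: "f * p = p * f"
  proof -
    have "f * D = D * f" using jm_commute[OF f(1)] jm_commute[OF fm] by (simp add: D_def algebra_simps)
    then show ?thesis using sw_commute[OF f(1)] by (simp add: p_def algebra_simps) (metis mult.assoc)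
  qed
  have "f * root_prod cs ?Y * (p * p) = f * (root_prod cs ?Y * p) * p" by (simp add: mult.assoc)
  also have "\<dots> = (f * p) * root_prod cs ?X * p"
    by (simp add: root_prod_intertwine[OF pX, symmetric] mult.assoc)
  also have "\<dots> = p * (f * root_prod cs ?X) * p" by (simp add: fp mult.assoc)
  finally have "f * root_prod cs ?Y * (1 - D * D) = 0" using f(2) pp by simp
  then have "(e * f) * root_prod cs ?Y * (1 - D * D) = 0" by (simp add: mult.assoc)
  then have 0: "e * root_prod cs ?Y * (1 - D * D) = 0" by (simp add: e)
  have X: "?X * root_prod cs ?Y = root_prod cs ?Y * ?X"
    by (rule root_prod_intertwine[OF rel(3)])
  define u where "u = e * root_prod cs ?Y"
  have uX: "u * ?X = c *s u"
    unfolding u_def mult.assoc X[symmetric] by (simp add: mult.assoc[symmetric] e)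
  have uYX: "u * ?Y * ?X = c *s (u * ?Y)"
    unfolding mult.assoc rel(3)[symmetric] by (simp add: mult.assoc[symmetric] uX)
  have uD: "u * D = c *s u - u * ?Y" by (simp add: D_def right_diff_distrib uX)
  have "u * D * D = (c *s u - u * ?Y) * D" by (simp only: uD)
  also have "\<dots> = c *s (u * D) - u * ?Y * D" by (simp add: left_diff_distrib)
  also have "u * ?Y * D = c *s (u * ?Y) - u * ?Y * ?Y" by (simp add: D_def right_diff_distrib uYX)
  finally have uDD: "u * D * D = c *s (c *s u - u * ?Y) - (c *s (u * ?Y) - u * ?Y * ?Y)" unfolding uD .
  \<comment> \<open>On \<open>u\<close> the element \<open>X\<close> acts from the right as
    \<open>c\<close>, so \<open>(X - Y)^2 - 1\<close> turns into
    \<open>(Y - (c + 1)) (Y - (c - 1))\<close>. This is the origin of the two new roots.\<close>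
  have "u * root_prod [c + 1, c - 1] ?Y = u * D * D - u"
    unfolding uDD by (simp add: algebra_simps)
  also have "\<dots> = - (u * (1 - D * D))" by (simp add: algebra_simps)
  also have "\<dots> = 0" using 0 by (simp add: u_def)
  finally show ?thesis by (simp only: root_prod_append u_def mult.assoc[symmetric])
qed

text \<open>Elements that are either zero or, up to a scalar, inverse to \<open>Y - c\<close> in the corner of \<open>e\<close>.\<close>

definition resolvents :: "nat \<Rightarrow> 'r \<Rightarrow> 'r set" where
  "resolvents m e = {w. \<exists>c k. jm (Suc m) * w = c *s w + k *s e \<and> w * jm (Suc m) = c *s w + k *s e \<and>
     (k = 0 \<longrightarrow> w = 0)}"

section \<open>Corners of the next group algebra\<close>

lemma subspace_corner: "subspace V \<Longrightarrow> subspace {a. u * a * v \<in> V}"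
  by (auto simp: subspace_def algebra_simps)

text \<open>By the double coset decomposition only \<open>e b s b' e\<close> matters, and inserting
  \<open>\<Sum>B\<close> on both sides of \<open>s\<close> leaves terms indexed by pairs
  \<open>g\<close>, \<open>g'\<close>. Equal indices give resolvents; different ones contribute
  nothing.\<close>

lemma gt_pair_corner:
  assumes gt: "gt_pair m C B" and e: "e \<in> B" and a: "a \<in> group_alg (Suc (Suc m))"
  shows "e * a * e \<in> span (insert e (resolvents m e))" (is "_ \<in> ?V")
proof -
  let ?A = "group_alg (Suc m)" and ?Y = "jm (Suc m)"
  have B: "split_family ?A B" and sumB: "\<Sum>B = 1" and CA: "C \<subseteq> group_alg m"
    using gt by (simp_all add: gt_pair_def)
  note BD = split_familyD[OF B]
  have S: "corner_semiprime ?A B"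
    using B by (intro group_alg_corner_semiprime) (simp add: split_family_def)
  note A = subalg_group_alg[of "Suc m"]
  have term_in: "(e * b * g) * sw m * (g' * b' * e) \<in> ?V"
    if b: "b \<in> ?A" "b' \<in> ?A" and g: "g \<in> B" "g' \<in> B" for b b' g g'
  proof (cases "e * b * g = 0 \<or> g' * b' * e = 0")
    case True
    then have "(e * b * g) * sw m * (g' * b' * e) = 0" by auto
    then show ?thesis by (simp only: span_zero)
  next
    case False
    then have nz: "e * b * g \<noteq> 0" "g' * b' * e \<noteq> 0" by auto
    obtain f where f: "f \<in> C" "f * g = g" "g * f = g" using gt g unfolding gt_pair_def by blast
    obtain f' where f': "f' \<in> C" "f' * g' = g'" "g' * f' = g'" using gt g unfolding gt_pair_def by blast
    show ?thesis
    proof (cases "g = g'")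
      case True
      define l r where "l = e * b * g" and "r = g * b' * e"
      have lr: "l \<in> ?A" "r \<in> ?A" unfolding l_def r_def using BD(1) e g b by (auto intro!: subalg_mult[OF A])
      obtain c where c: "jm m * g = c *s g" "g * jm m = c *s g" using gt g unfolding gt_pair_def by blast
      have "e * (b * g * g * b') * e \<in> range (\<lambda>k. k *s e)"
        using BD(5)[OF e, of "b * g * g * b'"] b BD(1)[OF g(1)] by (auto intro!: subalg_mult[OF A])
      then obtain k where k: "l * r = k *s e" by (auto simp: l_def r_def mult.assoc)
      let ?w = "l * sw m * r"
      have Xr: "jm m * r = c *s r" by (simp add: r_def mult.assoc[symmetric] c)
      have lX: "l * jm m = c *s l" by (simp add: l_def mult.assoc c)
      \<comment> \<open>\<open>Y\<close> commutes with \<open>l\<close>, and exchanging it with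
        \<open>s\<close> turns it into \<open>X\<close>, which acts on \<open>r\<close> as
        \<open>c\<close>; the correction term is \<open>l r = k e\<close>.\<close>
      have "?Y * ?w = (?Y * l) * sw m * r" by (simp add: mult.assoc)
      also have "\<dots> = l * (?Y * sw m) * r" by (simp add: jm_commute[OF lr(1), symmetric] mult.assoc)
      also have "?Y * sw m = sw m * jm m + 1" by (simp add: jm_sw_relations(1))
      also have "l * (sw m * jm m + 1) * r = l * sw m * (jm m * r) + l * r"
        by (simp add: distrib_left distrib_right mult.assoc)
      finally have 1: "?Y * ?w = c *s ?w + k *s e" by (simp add: Xr k)
      have "?w * ?Y = l * (sw m * ?Y) * r" by (simp add: jm_commute[OF lr(2)] mult.assoc)
      also have "\<dots> = (l * jm m) * sw m * r + l * r"
        by (simp add: jm_sw_relations(2) distrib_left distrib_right mult.assoc)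
      finally have 2: "?w * ?Y = c *s ?w + k *s e" by (simp add: lX k)
      \<comment> \<open>Membership in \<open>resolvents\<close> allows \<open>k = 0\<close> only for
        \<open>w = 0\<close>, so the product of the two corner elements has to be shown
        nonzero.\<close>
      have "e * b * g * (b' * e) \<noteq> 0"
        by (rule corner_mult_nonzero[OF A B S e g(1) b(1) nz(1)]) (use nz(2) True in \<open>simp add: mult.assoc\<close>)
      then have "l * r \<noteq> 0" using BD(3)[OF g(1)] by (simp add: l_def r_def mult.assoc idem_absorb)
      then have "k \<noteq> 0" using k by auto
      then have "?w \<in> resolvents m e" using 1 2 unfolding resolvents_def by blast
      then show ?thesis unfolding l_def r_def True[symmetric] by (intro span_base) simp
    next
      case False
      show ?thesis
      proof (cases "f = f'")
        case True
        \<comment> \<open>Both \<open>g\<close> and \<open>g'\<close> are linked to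
          \<open>e\<close>, hence to each other, which contradicts multiplicity-freeness below the
          common \<open>f\<close>.\<close>
        obtain r where r: "r \<in> ?A" "g * r * e = r" "r * (e * b * g) = g"
          by (rule corner_inverse[OF A B S e g(1) b(1) nz(1)])
        obtain r' where r': "r' \<in> ?A" "e * r' * g' = r'" "r' * (g' * b' * e) = e"
          by (rule corner_inverse[OF A B S g(2) e b(2) nz(2)])
        have "\<forall>a\<in>?A. g * a * g' = 0"
          using gt f f' g False True unfolding gt_pair_def by blast
        then have "g * (r * r') * g' = 0" using r(1) r'(1) by (blast intro: subalg_mult[OF A])
        moreover have "g * r = r" "r' * g' = r'" "r * e = r"
          using r(2) r'(2) BD(3)[OF g(1)] BD(3)[OF g(2)] BD(3)[OF e] by (metis mult.assoc)+
        ultimately have "r * r' = 0" by (metis mult.assoc)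
        then have "r * (r' * (g' * b' * e)) = 0" by (simp add: mult.assoc[symmetric])
        then have "r = 0" using r'(3) \<open>r * e = r\<close> by simp
        then have False using r(3) BD(2)[OF g(1)] by simp
        then show ?thesis ..
      next
        case False
        \<comment> \<open>Different branches: \<open>s\<close> commutes with \<open>f\<close>, so
          \<open>f\<close> can be moved across it to meet \<open>f'\<close>.\<close>
        then have ff: "f * f' = 0" using gt f f' unfolding gt_pair_def by blast
        have "g * sw m * g' = g * (f * sw m) * (f' * g')" using f f' by (simp add: mult.assoc[symmetric])
        also have "f * sw m = sw m * f" using f CA by (intro sw_commute) auto
        also have "g * (sw m * f) * (f' * g') = g * sw m * (f * f') * g'" by (simp add: mult.assoc)
        finally have "g * sw m * g' = 0" using ff by simp
        then have "e * b * (g * sw m * g') * b' * e = 0" by simp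
        then have "(e * b * g) * sw m * (g' * b' * e) = 0" by (simp add: mult.assoc)
        then show ?thesis by (simp only: span_zero)
      qed
    qed
  qed
  have "a \<in> {a. e * a * e \<in> ?V}" using a
  proof (rule group_alg_Suc_induct)
    show "subspace {a. e * a * e \<in> ?V}" by (rule subspace_corner) simp
    show "?A \<subseteq> {a. e * a * e \<in> ?V}"
    proof
      fix a assume "a \<in> ?A"
      then obtain c where "e * a * e = c *s e" using BD(5)[OF e] by blast
      then show "a \<in> {a. e * a * e \<in> ?V}" by (simp add: span_scale span_base)
    qed
    fix b b' assume b: "b \<in> ?A" "b' \<in> ?A"
    have "e * (b * sw m * b') * e = e * b * \<Sum>B * sw m * (\<Sum>B * b' * e)"
      by (simp add: sumB mult.assoc)
    also have "\<dots> = (\<Sum>g'\<in>B. \<Sum>g\<in>B. (e * b * g) * sw m * (g' * b' * e))"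
      by (simp add: sum_distrib_left sum_distrib_right)
    also have "\<dots> \<in> ?V" using term_in[OF b] by (intro span_sum)
    finally show "b * sw m * b' \<in> {a. e * a * e \<in> ?V}" by simp
  qed
  then show ?thesis by simp
qed

lemma resolvent_span_commute:
  assumes "e * jm (Suc m) = jm (Suc m) * e" "u \<in> span (insert e (resolvents m e))"
  shows "u * jm (Suc m) = jm (Suc m) * u"
  using assms(2)
  by (rule span_induct) (use assms(1) subspace_commutant in \<open>auto simp: resolvents_def\<close>)

text \<open>For an eigenvector \<open>h\<close> of value \<open>d\<close>, the resolvent equation
  reads \<open>(d - c) h w = k h\<close>, so \<open>h w\<close> is a multiple of \<open>h\<close>,
  or \<open>h w h'\<close> vanishes if \<open>d = c\<close>. For \<open>h = h'\<close> this yields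
  one-dimensional corners, for orthogonal \<open>h\<close>, \<open>h'\<close>
  multiplicity-freeness.\<close>

lemma resolvent_span_eigen:
  assumes h: "h * e = h" "h * jm (Suc m) = d *s h" and h': "e * h' = h'"
    and u: "u \<in> span (insert e (resolvents m e))"
  shows "\<exists>\<mu>. h * u * h' = \<mu> *s (h * h')"
proof -
  have "subspace (range (\<lambda>\<mu>. \<mu> *s (h * h')))"
    by (metis span_singleton subspace_span)
  then have sub: "subspace {u. h * u * h' \<in> range (\<lambda>\<mu>. \<mu> *s (h * h'))}"
    by (rule subspace_corner)
  have "h * u * h' \<in> range (\<lambda>\<mu>. \<mu> *s (h * h'))"
    using u
  proof (rule span_induct[OF _ sub])
    fix w assume "w \<in> insert e (resolvents m e)"
    then consider "w = e" | "w \<in> resolvents m e" by auto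
    then show "h * w * h' \<in> range (\<lambda>\<mu>. \<mu> *s (h * h'))"
    proof cases
      case 1
      then show ?thesis using h by (auto intro!: image_eqI[of _ _ 1])
    next
      case 2
      then obtain c k where w: "jm (Suc m) * w = c *s w + k *s e" "k = 0 \<Longrightarrow> w = 0"
        unfolding resolvents_def by auto
      have "h * (jm (Suc m) * w) = d *s (h * w)" using h(2) by (simp add: mult.assoc[symmetric])
      then have eq: "(d - c) *s (h * w) = k *s h"
        unfolding w(1) by (simp add: distrib_left h(1) scale_left_diff_distrib diff_eq_eq add.commute)
      show ?thesis
      proof (cases "d = c")
        case True
        then have "k = 0 \<or> h = 0" using eq by simp
        then have "h * w * h' = 0" using w(2) by auto
        then show ?thesis by (intro image_eqI[of _ _ 0]) auto
      next
        case False
        then have "h * w = inverse (d - c) *s ((d - c) *s (h * w))" by simp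
        also have "\<dots> = (inverse (d - c) * k) *s h" by (simp add: eq)
        finally have "h * w * h' = (inverse (d - c) * k) *s (h * h')" by simp
        then show ?thesis by blast
      qed
    qed
  qed
  then show ?thesis by auto
qed

lemma gt_pair_refine:
  assumes gt: "gt_pair m C B" and e: "e \<in> B"
  shows "\<exists>H. eigen_family {v \<in> group_alg (Suc (Suc m)). v * jm (Suc m) = jm (Suc m) * v} (jm (Suc m)) e H"
proof -
  let ?A = "group_alg (Suc (Suc m))" and ?Y = "jm (Suc m)"
  have B: "split_family (group_alg (Suc m)) B" using gt by (simp add: gt_pair_def)
  note eD = split_familyD[OF B e]
  note A = subalg_group_alg[of "Suc (Suc m)"]
  have eA: "e \<in> ?A" using eD(1) group_alg_mono[of "Suc m" "Suc (Suc m)"] by auto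
  have eY: "e * ?Y = ?Y * e" by (rule jm_commute[OF eD(1)])
  \<comment> \<open>The centre of the corner \<open>e A e\<close>. It is stable under
    \<open>Y\<close>, since the corner commutes with \<open>Y\<close>, and reduced, since
    \<open>v a v\<close> equals \<open>(e a e) v^2\<close> for \<open>v\<close> in it, so that
    \<open>v^2 = 0\<close> contradicts semiprimeness unless \<open>v = 0\<close>.\<close>
  define K where "K = {v \<in> ?A. e * v = v \<and> v * e = v \<and> v * ?Y = ?Y * v \<and>
     (\<forall>a\<in>?A. v * (e * a * e) = (e * a * e) * v)}"
  have corner: "(e * a * e) * ?Y = ?Y * (e * a * e)" if "a \<in> ?A" for a
    by (rule resolvent_span_commute[OF eY gt_pair_corner[OF gt e that]])
  have "\<exists>H. eigen_family K ?Y e H"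
  proof -
    obtain f where f: "f \<in> C" "e * f = e" using gt e unfolding gt_pair_def by blast
    obtain c where c: "e * jm m = c *s e" using gt e unfolding gt_pair_def by blast
    obtain cs where cs: "f * root_prod cs (jm m) = 0" using gt f(1) unfolding gt_pair_def by blast
    have "f \<in> group_alg m" using gt f(1) unfolding gt_pair_def by blast
    note kill = jm_root_prod_Suc[OF this cs f(2) c]
    show ?thesis
    proof (rule eigen_decomposition[OF _ _ _ _ _ eD(3) kill])
      show "subspace K" using subalg_subspace[OF A] unfolding K_def subspace_def
        by (auto simp: distrib_left distrib_right)
      show "v * ?Y = ?Y * v" if "v \<in> K" for v using that by (simp add: K_def)
      show "?Y * v \<in> K" if "v \<in> K" for v
      proof -
        have v: "v \<in> ?A" "e * v = v" "v * e = v" "v * ?Y = ?Y * v"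
          and vc: "\<And>a. a \<in> ?A \<Longrightarrow> v * (e * a * e) = (e * a * e) * v" using that by (auto simp: K_def)
        have "?Y * v \<in> ?A" using v(1) jm_in by (rule subalg_mult[OF A, rotated])
        moreover have "e * (?Y * v) = ?Y * v" using eY v(2) by (metis mult.assoc)
        moreover have "?Y * v * e = ?Y * v" using v(3) by (simp add: mult.assoc)
        moreover have "?Y * v * ?Y = ?Y * (?Y * v)" using v(4) by (simp add: mult.assoc)
        moreover have "?Y * v * (e * a * e) = (e * a * e) * (?Y * v)" if "a \<in> ?A" for a
        proof -
          have "?Y * v * (e * a * e) = (?Y * (e * a * e)) * v"
            unfolding mult.assoc[of ?Y v] vc[OF that] by (simp only: mult.assoc)
          then show ?thesis unfolding corner[OF that, symmetric] by (simp only: mult.assoc)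
        qed
        ultimately show ?thesis by (simp add: K_def)
      qed
      show "v = 0" if "v \<in> K" "v * v = 0" for v
      proof (rule group_alg_semiprime[of 1 "Suc (Suc m)" v])
        show "v \<in> ?A" using that by (simp add: K_def)
        fix a assume a: "a \<in> ?A"
        have v: "e * v = v" "v * e = v" "v * (e * a * e) = (e * a * e) * v"
          using that(1) a by (simp_all add: K_def)
        have "v * a * v = (v * e) * a * (e * v)" by (simp only: v(1,2))
        also have "\<dots> = v * (e * a * e) * v" by (simp only: mult.assoc)
        also have "\<dots> = (e * a * e) * (v * v)" unfolding v(3) by (simp only: mult.assoc)
        finally show "v * a * v = 0" by (simp add: that(2))
      qed auto
      show "e \<in> K" unfolding K_def using eA eY eD(3) by (simp add: mult.assoc idem_absorb)
    qed
  qed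
  moreover have "K \<subseteq> {v \<in> ?A. v * ?Y = ?Y * v}" by (auto simp: K_def)
  ultimately show ?thesis using eigen_family_mono by blast
qed

text \<open>The new family collects the eigenprojections of all \<open>e\<close> in
  \<open>B\<close>, and \<open>B\<close> takes over the role of \<open>C\<close>. Within one
  \<open>e\<close>, both the one-dimensional corners and the separation of different projections
  come from \<open>resolvent_span_eigen\<close>.\<close>

lemma gt_pair_Suc:
  assumes gt: "gt_pair m C B"
  shows "\<exists>B'. gt_pair (Suc m) B B'"
proof -
  let ?A = "group_alg (Suc (Suc m))" and ?Y = "jm (Suc m)"
  have B: "split_family (group_alg (Suc m)) B" and sumB: "\<Sum>B = 1" using gt by (simp_all add: gt_pair_def)
  note BD = split_familyD[OF B]
  obtain H where H: "\<And>e. e \<in> B \<Longrightarrow> eigen_family {v \<in> ?A. v * ?Y = ?Y * v} ?Y e (H e)"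
    using gt_pair_refine[OF gt] by metis
  note HD = eigen_familyD[OF H]
  have cross: "h * h' = 0" if "e \<in> B" "e' \<in> B" "h \<in> H e" "h' \<in> H e'" "e \<noteq> e'" for e e' h h'
  proof -
    have "h * h' = h * (e * e') * h'"
      using HD(8)[OF that(1,3)] HD(7)[OF that(2,4)] by (metis mult.assoc)
    then show ?thesis using BD(4)[OF that(1,2,5)] by simp
  qed
  have disj: "e = e'" if "e \<in> B" "e' \<in> B" "h \<in> H e" "h \<in> H e'" for e e' h
    using cross[OF that] HD(5)[OF that(1,3)] HD(3)[OF that(1)] that by metis
  have hY: "\<exists>d. ?Y * h = d *s h \<and> h * ?Y = d *s h" if "e \<in> B" "h \<in> H e" for e h
    using HD(9)[OF that] HD(2)[OF that(1)] that by auto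
  have corner: "\<exists>\<mu>. h * a * h' = \<mu> *s (h * h')"
    if "e \<in> B" "h \<in> H e" "h' \<in> H e" "a \<in> ?A" for e h h' a
  proof -
    from hY[OF that(1,2)] obtain d where d: "h * ?Y = d *s h" by blast
    have "h * a * h' = h * (e * a * e) * h'"
      using HD(8)[OF that(1,2)] HD(7)[OF that(1,3)] by (metis mult.assoc)
    then show ?thesis
      using resolvent_span_eigen[OF HD(8)[OF that(1,2)] d HD(7)[OF that(1,3)]
        gt_pair_corner[OF gt that(1,4)]] by simp
  qed
  define B' where "B' = (\<Union>e\<in>B. H e)"
  have B'E: "\<exists>e\<in>B. h \<in> H e" if "h \<in> B'" for h using that by (auto simp: B'_def)
  have finB: "finite B" using B by (simp add: split_family_def)
  have orth: "h * h' = 0" if "h \<in> B'" "h' \<in> B'" "h \<noteq> h'" for h h'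
  proof -
    from B'E[OF that(1)] B'E[OF that(2)]
    obtain e e' where "e \<in> B" "h \<in> H e" "e' \<in> B" "h' \<in> H e'" by blast
    then show ?thesis using cross HD(6) that(3) by (cases "e = e'") auto
  qed
  have "split_family ?A B'"
    unfolding split_family_def
  proof (intro conjI ballI impI)
    show "finite B'" using finB HD(1) by (simp add: B'_def)
    show "B' \<subseteq> ?A" using HD(2) by (fastforce simp: B'_def)
    show "0 \<notin> B'" using HD(3) by (auto simp: B'_def)
    show "h * h = h" if "h \<in> B'" for h using B'E[OF that] HD(5) by blast
    show "h * h' = 0" if "h \<in> B'" "h' \<in> B'" "h \<noteq> h'" for h h' using that by (rule orth)
    show "\<exists>c. h * a * h = c *s h" if "h \<in> B'" "a \<in> ?A" for h a
    proof -
      from B'E[OF that(1)] obtain e where e: "e \<in> B" "h \<in> H e" by blast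
      show ?thesis using corner[OF e e(2) that(2)] HD(5)[OF e] by simp
    qed
  qed
  moreover have "\<Sum>B' = 1"
  proof -
    have "\<Sum>B' = (\<Sum>e\<in>B. \<Sum>(H e))" unfolding B'_def
      using finB HD(1) disj by (intro sum.UNION_disjoint) auto
    also have "\<dots> = \<Sum>B" by (intro sum.cong refl HD(4))
    finally show ?thesis using sumB by simp
  qed
  moreover have "B \<subseteq> group_alg (Suc m)" using BD(1) by blast
  moreover have "\<forall>f\<in>B. \<forall>f'\<in>B. f \<noteq> f' \<longrightarrow> f * f' = 0" using BD(4) by blast
  moreover have "\<forall>e\<in>B. \<exists>cs. e * root_prod cs ?Y = 0"
  proof
    fix e assume e: "e \<in> B"
    obtain f where f: "f \<in> C" "e * f = e" using gt e unfolding gt_pair_def by blast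
    obtain c where c: "e * jm m = c *s e" using gt e unfolding gt_pair_def by blast
    obtain cs where cs: "f * root_prod cs (jm m) = 0" using gt f(1) unfolding gt_pair_def by blast
    have "f \<in> group_alg m" using gt f(1) unfolding gt_pair_def by blast
    from jm_root_prod_Suc[OF this cs f(2) c] show "\<exists>cs. e * root_prod cs ?Y = 0" by blast
  qed
  moreover have "\<forall>g\<in>B'. (\<exists>f\<in>B. f * g = g \<and> g * f = g) \<and> (\<exists>c. ?Y * g = c *s g \<and> g * ?Y = c *s g)"
  proof
    fix g assume "g \<in> B'"
    then obtain e where e: "e \<in> B" "g \<in> H e" using B'E by blast
    show "(\<exists>f\<in>B. f * g = g \<and> g * f = g) \<and> (\<exists>c. ?Y * g = c *s g \<and> g * ?Y = c *s g)"
      using hY[OF e] HD(7)[OF e] HD(8)[OF e] e(1) by blast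
  qed
  moreover have "\<forall>f\<in>B. \<forall>g\<in>B'. \<forall>g'\<in>B'. g \<noteq> g' \<longrightarrow> f * g = g \<longrightarrow> f * g' = g' \<longrightarrow> (\<forall>a\<in>?A. g * a * g' = 0)"
  proof (intro ballI impI)
    fix f g g' a
    assume f: "f \<in> B" and g: "g \<in> B'" "g' \<in> B'" "g \<noteq> g'" "f * g = g" "f * g' = g'" and a: "a \<in> ?A"
    \<comment> \<open>A member of another \<open>H e\<close> would satisfy
      \<open>h = f h = f e h = 0\<close>.\<close>
    have in_f: "h \<in> H f" if "h \<in> B'" "f * h = h" for h
    proof -
      from B'E[OF that(1)] obtain e where e: "e \<in> B" "h \<in> H e" by blast
      have "f * e \<noteq> 0" using that(2) HD(7)[OF e] HD(3)[OF e(1)] e(2) by (metis mult.assoc mult_zero_left)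
      then show ?thesis using BD(4)[OF f e(1)] e(2) by auto
    qed
    obtain \<mu> where "g * a * g' = \<mu> *s (g * g')"
      using corner[OF f in_f[OF g(1,4)] in_f[OF g(2,5)] a] by blast
    then show "g * a * g' = 0" using orth[OF g(1-3)] by simp
  qed
  ultimately show ?thesis unfolding gt_pair_def by (intro exI[of _ B'] conjI)
qed

lemma gt_pair_0: "gt_pair 0 {1} {1}"
proof -
  have "group_alg (Suc 0) = span {1}" "group_alg 0 = span {1}"
    unfolding group_alg_def by (simp_all add: T_id)
  moreover have "jm 0 = 0" by (simp add: jm_def)
  moreover have "\<exists>cs. root_prod cs 0 = 0" by (rule exI[of _ "[0]"]) simp
  ultimately show ?thesis
    unfolding gt_pair_def split_family_def by (auto simp: span_singleton span_base)
qed

lemma group_alg_split_family: "\<exists>E. split_family (group_alg n) E \<and> \<Sum>E = 1"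
proof -
  have "\<exists>C B. gt_pair m C B" for m
    by (induction m) (use gt_pair_0 gt_pair_Suc in blast)+
  then have Suc: "\<exists>E. split_family (group_alg (Suc m)) E \<and> \<Sum>E = 1" for m
    unfolding gt_pair_def by blast
  \<comment> \<open>The pairs only reach the levels from 1 on; level 0 carries the same trivial
    group.\<close>
  have "group_alg 0 = group_alg (Suc 0)"
    unfolding group_alg_def by (simp add: T_id)
  then show ?thesis using Suc by (cases n) auto
qed

end

section \<open>The algebra of the rook monoid\<close>

text \<open>Partial injections of all natural numbers, so that one type serves every
  \<open>n\<close> and contains the permutations with a common unit. Composition is written
  additively because convolution of finitely supported maps is built on an additive monoid.\<close>

typedef rook = "{r :: (nat \<times> nat) set. single_valued r \<and> single_valued (r\<inverse>)}"
  morphisms rook_rel Abs_rook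
  by (rule exI[of _ "{}"]) auto

setup_lifting type_definition_rook

instantiation rook :: monoid_add
begin

lift_definition zero_rook :: rook is Id
  by auto

lift_definition plus_rook :: "rook \<Rightarrow> rook \<Rightarrow> rook" is "(O)"
  by (simp add: single_valued_relcomp converse_relcomp)

instance
  by standard (transfer; simp add: O_assoc)+

end

lift_definition idr :: "nat set \<Rightarrow> rook" is Id_on
  by (auto simp: single_valued_def)

text \<open>Relational composition reads from left to right, so the pairs are
  \<open>(p i, i)\<close>: this order makes \<open>p \<circ> q\<close> go to
  \<open>perm_rook p + perm_rook q\<close>. The identity is only a default for maps that are not
  injective.\<close>

lift_definition perm_rook :: "(nat \<Rightarrow> nat) \<Rightarrow> rook" is "\<lambda>p. if inj p then {(p i, i) |i. True} else Id"
  by (auto simp: single_valued_def inj_def)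

definition rscale :: "'a::field \<Rightarrow> (rook \<Rightarrow>\<^sub>0 'a) \<Rightarrow> (rook \<Rightarrow>\<^sub>0 'a)" (infixr \<open>*\<^sub>r\<close> 75) where
  "c *\<^sub>r f = Poly_Mapping.single 0 c * f"

definition mon :: "rook \<Rightarrow> (rook \<Rightarrow>\<^sub>0 'a::field)" where
  "mon r = Poly_Mapping.single r 1"

lemma mon_mult: "mon r * mon q = mon (r + q)"
  by (simp add: mon_def mult_single)

lemma mon_0: "mon 0 = 1"
  by (simp add: mon_def)

lemma poly_mapping_eq_sum: "f = (\<Sum>k\<in>Poly_Mapping.keys f. Poly_Mapping.single k (Poly_Mapping.lookup f k))"
proof (rule poly_mapping_eqI)
  fix k
  have "Poly_Mapping.lookup (\<Sum>k\<in>Poly_Mapping.keys f. Poly_Mapping.single k (Poly_Mapping.lookup f k)) k = (\<Sum>l\<in>Poly_Mapping.keys f. if k = l then Poly_Mapping.lookup f l else 0)"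
    by (simp add: lookup_sum lookup_single when_def eq_commute)
  then show "Poly_Mapping.lookup f k = Poly_Mapping.lookup (\<Sum>k\<in>Poly_Mapping.keys f. Poly_Mapping.single k (Poly_Mapping.lookup f k)) k"
    by (simp add: in_keys_iff)
qed

lemma single_0_central: "f * Poly_Mapping.single 0 c = Poly_Mapping.single 0 c * f"
  for f :: "'k::monoid_add \<Rightarrow>\<^sub>0 'a::comm_semiring_1"
  by (subst (1 2) poly_mapping_eq_sum)
    (simp add: sum_distrib_left sum_distrib_right mult_single mult.commute)

lemma rscale_mon: "c *\<^sub>r mon r = Poly_Mapping.single r c"
  by (simp add: rscale_def mon_def mult_single)

interpretation rook: field_algebra "rscale :: 'a::field \<Rightarrow> _"
proof
  fix a b :: 'a and x y :: "rook \<Rightarrow>\<^sub>0 'a"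
  show "a *\<^sub>r (x + y) = a *\<^sub>r x + a *\<^sub>r y" by (simp add: rscale_def distrib_left)
  show "(a + b) *\<^sub>r x = a *\<^sub>r x + b *\<^sub>r x" by (simp add: rscale_def single_add distrib_right)
  show "a *\<^sub>r b *\<^sub>r x = (a * b) *\<^sub>r x" by (simp add: rscale_def mult.assoc[symmetric] mult_single)
  show "1 *\<^sub>r x = x" by (simp add: rscale_def)
  show "(a *\<^sub>r x) * y = a *\<^sub>r (x * y)" by (simp add: rscale_def mult.assoc)
  show "x * (a *\<^sub>r y) = a *\<^sub>r (x * y)"
    unfolding rscale_def mult.assoc[symmetric] single_0_central ..
qed

interpretation rook: perm_algebra "rscale :: 'a::field_char_0 \<Rightarrow> _" "\<lambda>p. mon (perm_rook p)"
proof
  have "perm_rook id = 0" by transfer auto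
  then show "mon (perm_rook id) = (1 :: rook \<Rightarrow>\<^sub>0 'a)" by (simp add: mon_0)
  fix p q :: "nat \<Rightarrow> nat" and n assume "p permutes {1..n}" "q permutes {1..n}"
  then have "inj p" "inj q" by (auto intro: permutes_inj)
  then have "perm_rook (p \<circ> q) = perm_rook p + perm_rook q"
    by transfer (auto simp: inj_compose)
  then show "mon (perm_rook (p \<circ> q)) = (mon (perm_rook p) * mon (perm_rook q) :: rook \<Rightarrow>\<^sub>0 'a)"
    by (simp add: mon_mult)
qed

section \<open>Partial identities and Moebius inversion\<close>

lemma idr_add: "idr X + idr Y = idr (X \<inter> Y)"
  by transfer auto

lemma perm_rook_idr: "inj p \<Longrightarrow> perm_rook p + idr X = idr (p ` X) + perm_rook p"
  unfolding rook_rel_inject[symmetric] plus_rook.rep_eq idr.rep_eq perm_rook.rep_eq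
  by (auto simp: inj_eq)

lemma relcomp_Id_on_right:
  assumes "single_valued r"
  shows "r O Id_on Y = Id_on (r\<inverse> `` Y) O r"
proof (intro equalityI subrelI)
  fix i j assume "(i, j) \<in> r O Id_on Y"
  then have "(i, j) \<in> r" "j \<in> Y" by auto
  then show "(i, j) \<in> Id_on (r\<inverse> `` Y) O r" by (intro relcompI[of i i]) auto
next
  fix i j assume "(i, j) \<in> Id_on (r\<inverse> `` Y) O r"
  then obtain j' where "(i, j') \<in> r" "j' \<in> Y" "(i, j) \<in> r" by auto
  moreover from this have "j' = j" using assms by (blast dest: single_valuedD)
  ultimately show "(i, j) \<in> r O Id_on Y" by (intro relcompI[of i j]) auto
qed

lemma rook_idr_right: "r + idr Y = idr ((rook_rel r)\<inverse> `` Y) + r"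
  using rook_rel[of r] relcomp_Id_on_right[of "rook_rel r" Y]
  unfolding rook_rel_inject[symmetric] plus_rook.rep_eq idr.rep_eq by simp

lemma rook_idr_left: "idr X + r = r + idr (rook_rel r `` X)"
proof -
  have "((rook_rel r)\<inverse> O Id_on X)\<inverse> = (Id_on (rook_rel r `` X) O (rook_rel r)\<inverse>)\<inverse>"
    using rook_rel[of r] relcomp_Id_on_right[of "(rook_rel r)\<inverse>" X] by simp
  then show ?thesis
    unfolding rook_rel_inject[symmetric] plus_rook.rep_eq idr.rep_eq by (simp add: converse_relcomp)
qed

text \<open>The Moebius idempotents, determined by \<open>idr X = (\<Sum>Y\<subseteq>X. moebius Y)\<close>.\<close>

function moebius :: "nat set \<Rightarrow> (rook \<Rightarrow>\<^sub>0 'a::field)" where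
  "moebius X = (if finite X then mon (idr X) - (\<Sum>Y\<in>Pow X - {X}. moebius Y) else 0)"
  by auto
termination
  by (relation "measure card") (auto intro!: psubset_card_mono)

declare moebius.simps [simp del]

lemma sum_moebius:
  assumes "finite X"
  shows "(\<Sum>Y\<in>Pow X. moebius Y) = mon (idr X)"
proof -
  have "(\<Sum>Y\<in>Pow X. moebius Y) = moebius X + (\<Sum>Y\<in>Pow X - {X}. moebius Y)"
    using assms by (intro sum.remove) auto
  then show ?thesis using assms by (simp add: moebius.simps[of X])
qed

text \<open>By induction, multiplying the subtracted sum by \<open>idr Z\<close> keeps the terms
  with \<open>Y \<subseteq> Z\<close>. If \<open>X\<close> is not inside \<open>Z\<close>, these are
  all subsets of \<open>X \<inter> Z\<close> and add up to \<open>idr (X \<inter> Z)\<close>, so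
  everything cancels.\<close>

lemma mon_idr_moebius:
  fixes X :: "nat set"
  assumes "finite X"
  shows "mon (idr Z) * (moebius X :: rook \<Rightarrow>\<^sub>0 'a::field) = (if X \<subseteq> Z then moebius X else 0) \<and>
         (moebius X :: rook \<Rightarrow>\<^sub>0 'a) * mon (idr Z) = (if X \<subseteq> Z then moebius X else 0)"
  using assms
proof (induction "card X" arbitrary: X rule: less_induct)
  case less
  let ?M = "moebius :: nat set \<Rightarrow> (rook \<Rightarrow>\<^sub>0 'a)"
  let ?S = "\<Sum>Y\<in>Pow X - {X}. if Y \<subseteq> Z then ?M Y else 0"
  have IH: "mon (idr Z) * ?M Y = (if Y \<subseteq> Z then ?M Y else 0)"
     "?M Y * mon (idr Z) = (if Y \<subseteq> Z then ?M Y else 0)" if "Y \<in> Pow X - {X}" for Y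
  proof -
    have "card Y < card X" "finite Y"
      using that less.prems by (auto intro!: psubset_card_mono intro: finite_subset)
    then show "mon (idr Z) * ?M Y = (if Y \<subseteq> Z then ?M Y else 0)"
     "?M Y * mon (idr Z) = (if Y \<subseteq> Z then ?M Y else 0)" using less.hyps by auto
  qed
  have M: "?M X = mon (idr X) - (\<Sum>Y\<in>Pow X - {X}. ?M Y)"
    using less.prems by (subst moebius.simps) simp
  have 1: "mon (idr Z) * ?M X = mon (idr (X \<inter> Z)) - ?S"
    unfolding M using IH(1) by (simp add: right_diff_distrib sum_distrib_left mon_mult idr_add Int_commute)
  have 2: "?M X * mon (idr Z) = mon (idr (X \<inter> Z)) - ?S"
    unfolding M using IH(2) by (simp add: left_diff_distrib sum_distrib_right mon_mult idr_add)
  have "mon (idr (X \<inter> Z)) - ?S = (if X \<subseteq> Z then ?M X else 0)"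
  proof (cases "X \<subseteq> Z")
    case True
    then have "?S = (\<Sum>Y\<in>Pow X - {X}. ?M Y)" by (intro sum.cong) auto
    then show ?thesis using True M by (simp add: Int_absorb2)
  next
    case False
    have "?S = (\<Sum>Y\<in>Pow (X \<inter> Z). ?M Y)"
      using less.prems False by (intro sum.mono_neutral_cong_right) auto
    also have "\<dots> = mon (idr (X \<inter> Z))" using less.prems by (intro sum_moebius) auto
    finally show ?thesis using False by simp
  qed
  then show ?case using 1 2 by simp
qed

lemma moebius_idr_self: "finite X \<Longrightarrow> moebius X * mon (idr X) = moebius X"
  "finite X \<Longrightarrow> mon (idr X) * moebius X = moebius X"
  by (simp_all add: mon_idr_moebius)

text \<open>For \<open>X \<noteq> Y\<close> one of the sets is not contained in the other, and the
  partial identity of that other one, inserted between the factors, kills the product.\<close>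

lemma moebius_mult:
  assumes "finite X" "finite Y"
  shows "moebius X * (moebius Y :: rook \<Rightarrow>\<^sub>0 'a::field) = (if X = Y then moebius X else 0)"
proof -
  let ?M = "moebius :: nat set \<Rightarrow> (rook \<Rightarrow>\<^sub>0 'a)"
  have ne: "?M X * ?M Y = 0" if "X \<noteq> Y" "finite X" "finite Y" for X Y
  proof (cases "X \<subseteq> Y")
    case False
    have "?M X * ?M Y = (?M X * mon (idr Y)) * ?M Y"
      using that by (simp add: mult.assoc moebius_idr_self)
    then show ?thesis using False that by (simp add: mon_idr_moebius)
  next
    case True
    have "?M X * ?M Y = ?M X * (mon (idr X) * ?M Y)"
      using that by (simp add: mult.assoc[symmetric] moebius_idr_self)
    then show ?thesis using True that by (auto simp: mon_idr_moebius)
  qed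
  have "?M X * moebius X = ?M X * mon (idr X) - (\<Sum>Y\<in>Pow X - {X}. ?M X * ?M Y)"
    using assms by (subst (2) moebius.simps) (simp add: right_diff_distrib sum_distrib_left)
  also have "(\<Sum>Y\<in>Pow X - {X}. ?M X * ?M Y) = 0"
    using assms by (intro sum.neutral) (auto intro!: ne intro: finite_subset)
  finally show ?thesis using ne assms by (auto simp: moebius_idr_self)
qed

lemma perm_moebius:
  fixes X :: "nat set"
  assumes "inj p" "finite X"
  shows "mon (perm_rook p) * (moebius X :: rook \<Rightarrow>\<^sub>0 'a::field) = moebius (p ` X) * mon (perm_rook p)"
  using assms(2)
proof (induction "card X" arbitrary: X rule: less_induct)
  case less
  let ?M = "moebius :: nat set \<Rightarrow> (rook \<Rightarrow>\<^sub>0 'a)"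
  have IH: "mon (perm_rook p) * ?M Y = ?M (p ` Y) * mon (perm_rook p)" if "Y \<in> Pow X - {X}" for Y
  proof (rule less.hyps)
    show "card Y < card X" "finite Y"
      using that less.prems by (auto intro!: psubset_card_mono intro: finite_subset)
  qed
  have "mon (perm_rook p) * ?M X =
     mon (idr (p ` X) + perm_rook p) - (\<Sum>Y\<in>Pow X - {X}. ?M (p ` Y) * mon (perm_rook p))"
    using less.prems assms(1) IH
    by (subst moebius.simps) (simp add: right_diff_distrib sum_distrib_left mon_mult perm_rook_idr)
  also have "(\<Sum>Y\<in>Pow X - {X}. ?M (p ` Y) * mon (perm_rook p)) =
     (\<Sum>Y\<in>Pow (p ` X) - {p ` X}. ?M Y * mon (perm_rook p))"
    using assms(1)
    by (intro sum.reindex_bij_witness[where i = "(-`) p" and j = "(`) p"])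
      (auto simp: inj_vimage_image_eq inj_image_eq_iff dest: injD)
  also have "mon (idr (p ` X) + perm_rook p) - \<dots> = ?M (p ` X) * mon (perm_rook p)"
    using less.prems
    by (subst (2) moebius.simps) (simp add: left_diff_distrib sum_distrib_right mon_mult)
  finally show ?case .
qed

text \<open>Pushing \<open>idr Y\<close> and \<open>idr X\<close> through \<open>r\<close> gives the
  inclusions of \<open>X\<close> in the preimage of \<open>Y\<close> and of \<open>Y\<close> in the
  image of \<open>X\<close>; as \<open>r\<close> is a partial injection, both become equalities.
  Only rooks matching \<open>X\<close> with \<open>Y\<close> bijectively survive.\<close>

lemma moebius_mon_moebius:
  assumes "finite X" "finite Y" "(moebius X :: rook \<Rightarrow>\<^sub>0 'a::field) * mon r * moebius Y \<noteq> 0"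
  shows "X = (rook_rel r)\<inverse> `` Y" "Y = rook_rel r `` X"
proof -
  let ?M = "moebius :: nat set \<Rightarrow> (rook \<Rightarrow>\<^sub>0 'a)"
  have "?M X * mon r * ?M Y = ?M X * mon (r + idr Y) * ?M Y"
    using assms by (simp add: mon_mult[symmetric] mult.assoc moebius_idr_self)
  also have "\<dots> = (?M X * mon (idr ((rook_rel r)\<inverse> `` Y))) * mon r * ?M Y"
    by (simp add: mon_mult[symmetric] mult.assoc rook_idr_right)
  finally have XY: "X \<subseteq> (rook_rel r)\<inverse> `` Y" using assms(1,3) by (auto simp: mon_idr_moebius split: if_splits)
  have "?M X * mon r * ?M Y = ?M X * mon (idr X + r) * ?M Y"
    using assms by (simp add: mon_mult[symmetric] mult.assoc[symmetric] moebius_idr_self)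
  also have "\<dots> = ?M X * mon r * (mon (idr (rook_rel r `` X)) * ?M Y)"
    by (simp add: mon_mult[symmetric] mult.assoc rook_idr_left)
  finally have YX: "Y \<subseteq> rook_rel r `` X" using assms(2,3) by (auto simp: mon_idr_moebius split: if_splits)
  have "single_valued (rook_rel r)" "single_valued ((rook_rel r)\<inverse>)" using rook_rel[of r] by auto
  note r = this
  have sv: "j = j'" if "(i, j) \<in> rook_rel r" "(i, j') \<in> rook_rel r" for i j j'
    using that r(1) unfolding single_valued_def by blast
  have vs: "i = i'" if "(i, j) \<in> rook_rel r" "(i', j) \<in> rook_rel r" for i i' j
    using that r(2) unfolding single_valued_def by blast
  show "X = (rook_rel r)\<inverse> `` Y"
  proof (intro equalityI XY subsetI)
    fix i assume "i \<in> (rook_rel r)\<inverse> `` Y"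
    then obtain j where "(i, j) \<in> rook_rel r" "j \<in> Y" by auto
    moreover from this obtain i' where "i' \<in> X" "(i', j) \<in> rook_rel r" using YX by auto
    ultimately show "i \<in> X" using vs by metis
  qed
  show "Y = rook_rel r `` X"
  proof (intro equalityI YX subsetI)
    fix j assume "j \<in> rook_rel r `` X"
    then obtain i where "(i, j) \<in> rook_rel r" "i \<in> X" by auto
    moreover from this obtain j' where "j' \<in> Y" "(i, j') \<in> rook_rel r" using XY by auto
    ultimately show "j \<in> Y" using sv by metis
  qed
qed

section \<open>The monoid algebra on n points and its corners\<close>

definition rook_alg :: "nat \<Rightarrow> (rook \<Rightarrow>\<^sub>0 'a::field) set" where
  "rook_alg n = rook.span (mon ` {r. rook_rel r \<subseteq> {1..n} \<times> {1..n}})"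

abbreviation pmon :: "(nat \<Rightarrow> nat) \<Rightarrow> (rook \<Rightarrow>\<^sub>0 'a::field)" where
  "pmon p \<equiv> mon (perm_rook p)"

lemma mon_in_rook_alg: "rook_rel r \<subseteq> {1..n} \<times> {1..n} \<Longrightarrow> mon r \<in> rook_alg n"
  unfolding rook_alg_def by (auto intro: rook.span_base)

lemma rook_alg_induct [consumes 1, case_names subspace mon]:
  assumes "a \<in> rook_alg n" "rook.subspace {a. P a}"
    "\<And>r. rook_rel r \<subseteq> {1..n} \<times> {1..n} \<Longrightarrow> P (mon r)"
  shows "P a"
  using assms(1) unfolding rook_alg_def by (rule rook.span_induct) (use assms in auto)

lemma subspace_rook_alg: "rook.subspace (rook_alg n)"
  unfolding rook_alg_def by (rule rook.subspace_span)

lemma subalg_rook_alg: "rook.subalg (rook_alg n)"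
  unfolding rook.subalg_def
proof (intro conjI ballI subspace_rook_alg)
  fix u v :: "rook \<Rightarrow>\<^sub>0 'a" assume u: "u \<in> rook_alg n" and v: "v \<in> rook_alg n"
  from u show "u * v \<in> rook_alg n"
  proof (induction rule: rook_alg_induct)
    case (mon r)
    from v show ?case
    proof (induction rule: rook_alg_induct)
      case (mon q)
      have "rook_rel (r + q) \<subseteq> {1..n} \<times> {1..n}"
        unfolding plus_rook.rep_eq using mon \<open>rook_rel r \<subseteq> _\<close> by blast
      then show ?case by (simp add: mon_mult mon_in_rook_alg)
    qed (simp add: rook.subspace_def distrib_left rook.subalg_def subspace_rook_alg[unfolded rook.subspace_def])
  qed (simp add: rook.subspace_def distrib_right subspace_rook_alg[unfolded rook.subspace_def])
qed

lemma rook_alg_unit: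
  assumes "a \<in> rook_alg n"
  shows "mon (idr {1..n}) * a = a" "a * mon (idr {1..n}) = a"
proof -
  have "mon (idr {1..n}) * a = a \<and> a * mon (idr {1..n}) = a"
    using assms
  proof (induction rule: rook_alg_induct)
    case subspace
    then show ?case by (auto simp: rook.subspace_def distrib_left distrib_right)
  next
    case (mon r)
    then have "idr {1..n} + r = r" "r + idr {1..n} = r"
      unfolding rook_rel_inject[symmetric] plus_rook.rep_eq idr.rep_eq by auto
    then show ?case by (simp add: mon_mult)
  qed
  then show "mon (idr {1..n}) * a = a" "a * mon (idr {1..n}) = a" by auto
qed

text \<open>\<open>perm_rook p\<close> is the identity beyond \<open>n\<close> and so is not
  supported on \<open>{1..n}\<close>; the unit \<open>idr {1..n}\<close>, absorbed by
  \<open>a\<close>, cuts it down.\<close>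

lemma pmon_mult_rook_alg:
  assumes p: "p permutes {1..n}" and a: "a \<in> rook_alg n"
  shows "pmon p * a \<in> rook_alg n" "a * pmon p \<in> rook_alg n"
proof -
  have inj: "inj p" using p by (rule permutes_inj)
  have pn: "p ` {1..n} = {1..n}" using p by (rule permutes_image)
  have "rook_rel (perm_rook p + idr {1..n}) \<subseteq> {1..n} \<times> {1..n}"
  proof (rule subrelI)
    fix i j assume "(i, j) \<in> rook_rel (perm_rook p + idr {1..n})"
    then have "j \<in> {1..n}" "i = p j"
      unfolding plus_rook.rep_eq idr.rep_eq perm_rook.rep_eq using inj by auto
    then show "(i, j) \<in> {1..n} \<times> {1..n}" using permutes_in_image[OF p, of j] by simp
  qed
  then have 1: "mon (perm_rook p + idr {1..n}) \<in> rook_alg n" by (rule mon_in_rook_alg)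
  have "pmon p * a = mon (perm_rook p + idr {1..n}) * a"
    using rook_alg_unit(1)[OF a] by (simp add: mon_mult[symmetric] mult.assoc)
  then show "pmon p * a \<in> rook_alg n" using rook.subalg_mult[OF subalg_rook_alg 1 a] by simp
  have "a * pmon p = a * mon (idr {1..n} + perm_rook p)"
    using rook_alg_unit(2)[OF a] by (simp add: mon_mult[symmetric] mult.assoc[symmetric])
  also have "idr {1..n} + perm_rook p = perm_rook p + idr {1..n}" by (simp only: perm_rook_idr[OF inj] pn)
  finally show "a * pmon p \<in> rook_alg n" using rook.subalg_mult[OF subalg_rook_alg a 1] by simp
qed

lemma rook_alg_mult_group_alg:
  assumes a: "a \<in> rook_alg n" and b: "b \<in> rook.group_alg k" and k: "k \<le> n"
  shows "a * b \<in> rook_alg n"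
  using b
proof (induction rule: rook.group_alg_induct)
  case subspace
  show ?case by (rule rook.subspace_mult_left[OF subspace_rook_alg])
next
  case (T p)
  then have "p permutes {1..n}" by (rule permutes_subset) (use k in auto)
  then show ?case using a by (rule pmon_mult_rook_alg)
qed

lemma moebius_in_rook_alg: "X \<subseteq> {1..n} \<Longrightarrow> (moebius X :: rook \<Rightarrow>\<^sub>0 'a::field) \<in> rook_alg n"
proof (induction "card X" arbitrary: X rule: less_induct)
  case less
  have fin: "finite X" using less.prems by (rule finite_subset) simp
  have "(moebius Y :: rook \<Rightarrow>\<^sub>0 'a) \<in> rook_alg n" if "Y \<in> Pow X - {X}" for Y
  proof (rule less.hyps)
    show "card Y < card X" "Y \<subseteq> {1..n}" using that less.prems fin by (auto intro!: psubset_card_mono)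
  qed
  moreover have "rook_rel (idr X) \<subseteq> {1..n} \<times> {1..n}" using less.prems by (auto simp: idr.rep_eq)
  ultimately show ?case using fin
    by (subst moebius.simps)
      (auto intro!: rook.subalg_diff[OF subalg_rook_alg] rook.subalg_sum[OF subalg_rook_alg] mon_in_rook_alg)
qed

lemma moebius_commute:
  assumes "a \<in> rook.group_alg k"
  shows "a * moebius {1..k} = moebius {1..k} * a"
  using assms
proof (induction rule: rook.group_alg_induct)
  case (T p)
  then show ?case using perm_moebius[OF permutes_inj[OF T], of "{1..k}"] permutes_image[OF T] by simp
qed (rule rook.subspace_commutant)

text \<open>A rook that survives between the two idempotents maps one initial segment bijectively to
  the other. Hence \<open>k = l\<close>, and next to \<open>moebius {1..k}\<close> the rook cannot
  be told from a permutation.\<close>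

lemma moebius_corner:
  fixes a :: "rook \<Rightarrow>\<^sub>0 'a::field_char_0"
  assumes "a \<in> rook_alg n"
  shows "\<exists>b\<in>rook.group_alg k. moebius {1..k} * a * moebius {1..l} = (if k = l then moebius {1..k} * b else 0)"
proof -
  let ?N = "moebius {1..k} :: rook \<Rightarrow>\<^sub>0 'a" and ?G = "rook.group_alg k :: (rook \<Rightarrow>\<^sub>0 'a) set"
  let ?V = "if k = l then (\<lambda>b. ?N * b) ` ?G else {0}"
  have "rook.subspace ((\<lambda>b. ?N * b) ` ?G)"
    using rook.subspace_group_alg[of k, where 'a = 'a] unfolding rook.subspace_def
    by (auto simp: image_iff) (metis mult_zero_right, metis distrib_left, metis rook.scale_mult_right)
  then have V: "rook.subspace ?V" by (auto simp: rook.subspace_single_0)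
  from assms have "?N * a * moebius {1..l} \<in> ?V"
  proof (induction rule: rook_alg_induct)
    case subspace
    show ?case by (rule rook.subspace_corner[OF V])
  next
    case (mon r)
    show ?case
    proof (cases "?N * mon r * moebius {1..l} = 0")
      case True
      then show ?thesis using rook.subspace_0[OF V] by simp
    next
      case False
      have X: "{1..k} = (rook_rel r)\<inverse> `` {1..l}" and Y: "{1..l} = rook_rel r `` {1..k}"
        by (rule moebius_mon_moebius[OF finite_atLeastAtMost finite_atLeastAtMost False])+
      have sv: "single_valued (rook_rel r)" "single_valued ((rook_rel r)\<inverse>)" using rook_rel[of r] by auto
      have ex: "\<exists>i. (i, j) \<in> rook_rel r \<and> i \<in> {1..k}" if "j \<in> {1..l}" for j
        using that unfolding Y by blast
      \<comment> \<open>The first component as a function of the second, in agreement with the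
        orientation of \<open>perm_rook\<close>.\<close>
      define f where "f j = (SOME i. (i, j) \<in> rook_rel r \<and> i \<in> {1..k})" for j
      have f: "(f j, j) \<in> rook_rel r" "f j \<in> {1..k}" if "j \<in> {1..l}" for j
        using someI_ex[OF ex[OF that]] by (auto simp: f_def)
      have bij: "bij_betw f {1..l} {1..k}"
      proof (rule bij_betw_imageI)
        show "inj_on f {1..l}"
          by (rule inj_onI) (metis f(1) single_valuedD[OF sv(1)])
        show "f ` {1..l} = {1..k}"
        proof (intro equalityI subsetI)
          fix i assume "i \<in> {1..k}"
          then obtain j where j: "j \<in> {1..l}" "(i, j) \<in> rook_rel r" using X by blast
          then have "f j = i" using f(1)[OF j(1)] single_valuedD[OF sv(2)] by blast
          then show "i \<in> f ` {1..l}" using j(1) by blast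
        qed (use f(2) in blast)
      qed
      then have kl: "k = l" using bij_betw_same_card by fastforce
      define p where "p j = (if j \<in> {1..k} then f j else j)" for j
      have "bij_betw p {1..k} {1..k}"
        using bij kl by (subst bij_betw_cong[of _ p f]) (auto simp: p_def)
      then have p: "p permutes {1..k}" by (rule bij_imp_permutes) (auto simp: p_def)
      \<comment> \<open>Only this restriction of \<open>r\<close> matters, because \<open>?N\<close>
        absorbs \<open>mon (idr {1..k})\<close>.\<close>
      have "idr {1..k} + r = idr {1..k} + perm_rook p"
      proof -
        have "Id_on {1..k} O rook_rel r = Id_on {1..k} O {(p i, i) |i. True}"
        proof (intro equalityI subrelI)
          fix i j assume "(i, j) \<in> Id_on {1..k} O rook_rel r"
          then have ij: "i \<in> {1..k}" "(i, j) \<in> rook_rel r" by auto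
          then have j: "j \<in> {1..l}" unfolding Y by blast
          then have "f j = i" using f(1)[OF j] ij single_valuedD[OF sv(2)] by blast
          then have "p j = i" using j kl by (simp add: p_def)
          then show "(i, j) \<in> Id_on {1..k} O {(p i, i) |i. True}" using ij by blast
        next
          fix i j assume "(i, j) \<in> Id_on {1..k} O {(p i, i) |i. True}"
          then have ij: "p j \<in> {1..k}" "i = p j" by auto
          then have "j \<in> {1..k}" using permutes_in_image[OF p] by blast
          then have "(i, j) \<in> rook_rel r" using f(1)[of j] kl ij by (simp add: p_def)
          then show "(i, j) \<in> Id_on {1..k} O rook_rel r" using ij by blast
        qed
        then show ?thesis
          unfolding rook_rel_inject[symmetric] plus_rook.rep_eq idr.rep_eq perm_rook.rep_eq
          by (simp add: permutes_inj[OF p])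
      qed
      then have "?N * mon (idr {1..k}) * mon r = ?N * mon (idr {1..k}) * pmon p"
        by (simp add: mult.assoc mon_mult)
      then have "?N * mon r = ?N * pmon p" by (simp add: moebius_idr_self)
      also have pN: "\<dots> = pmon p * ?N" by (rule moebius_commute[OF rook.T_in[OF p], symmetric])
      finally have "?N * mon r * ?N = pmon p * (?N * ?N)" by (simp add: mult.assoc)
      also have "\<dots> = ?N * pmon p"
        using pN by (simp add: moebius_mult)
      finally show ?thesis using kl rook.T_in[OF p] by auto
    qed
  qed
  then show ?thesis using rook.one_in[of k, where 'a = 'a] by (auto split: if_splits)
qed

text \<open>Conjugating by such a permutation transports the corner of \<open>moebius X\<close> to
  that of the initial segment of the same size.\<close>

lemma exists_permutes_image:
  assumes "X \<subseteq> {1..n::nat}"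
  shows "\<exists>p. p permutes {1..n} \<and> p ` {1..card X} = X"
proof -
  have fin: "finite X" using assms by (rule finite_subset) simp
  have k: "card X \<le> n" using card_mono[OF _ assms] by simp
  obtain f where f: "bij_betw f {1..card X} X"
    using fin by (metis card_atLeastAtMost diff_Suc_1 finite_atLeastAtMost finite_same_card_bij)
  have "card ({1..n} - {1..card X}) = card ({1..n} - X)"
    using assms k fin by (simp add: card_Diff_subset)
  then obtain g where g: "bij_betw g ({1..n} - {1..card X}) ({1..n} - X)"
    by (metis finite_Diff finite_atLeastAtMost finite_same_card_bij)
  define p where "p i = (if i \<in> {1..card X} then f i else if i \<in> {1..n} then g i else i)" for i
  have 1: "bij_betw p {1..card X} X" using f by (subst bij_betw_cong[of _ p f]) (auto simp: p_def)
  have "bij_betw p ({1..n} - {1..card X}) ({1..n} - X)"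
    using g by (subst bij_betw_cong[of _ p g]) (auto simp: p_def)
  from bij_betw_combine[OF 1 this]
  have "bij_betw p ({1..card X} \<union> ({1..n} - {1..card X})) (X \<union> ({1..n} - X))" by auto
  moreover have "{1..card X} \<union> ({1..n} - {1..card X}) = {1..n}" "X \<union> ({1..n} - X) = {1..n}"
    using assms k by auto
  ultimately have "bij_betw p {1..n} {1..n}" by simp
  then have "p permutes {1..n}" by (rule bij_imp_permutes) (use k in \<open>auto simp: p_def\<close>)
  moreover have "p ` {1..card X} = X" using 1 by (simp add: bij_betw_def)
  ultimately show ?thesis by blast
qed

text \<open>Every \<open>moebius X\<close> is conjugate to the \<open>moebius\<close> of an initial
  segment, whose corner is an image of a symmetric group algebra. The family for that group is cut
  down by the idempotent and transported back, for all \<open>X\<close> at once.\<close>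

lemma rook_alg_split_family:
  "\<exists>E :: (rook \<Rightarrow>\<^sub>0 'a::field_char_0) set. rook.split_family (rook_alg n) E \<and>
     rook.corner_semiprime (rook_alg n) E \<and> \<Sum>E = mon (idr {1..n})"
proof -
  let ?L = "rook_alg n :: (rook \<Rightarrow>\<^sub>0 'a) set"
  let ?G = "rook.group_alg :: nat \<Rightarrow> (rook \<Rightarrow>\<^sub>0 'a) set"
  note L = subalg_rook_alg[of n, where 'a = 'a]
  define N :: "nat \<Rightarrow> rook \<Rightarrow>\<^sub>0 'a" where "N k = moebius {1..k}" for k
  have NN: "N k * N k = N k" for k by (simp add: N_def moebius_mult)
  have Nc: "a * N k = N k * a" if "a \<in> ?G k" for a k
    unfolding N_def by (rule moebius_commute[OF that])
  have "\<forall>k. \<exists>E. rook.split_family (?G k) E \<and> \<Sum>E = 1"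
    by (intro allI rook.group_alg_split_family)
  then obtain F where "\<forall>k. rook.split_family (?G k) (F k) \<and> \<Sum>(F k) = 1" by (rule choice[THEN exE])
  then have F: "\<And>k. rook.split_family (?G k) (F k)" and sumF: "\<And>k. \<Sum>(F k) = 1" by auto
  note FD = rook.split_familyD[OF F]
  have "\<forall>X. \<exists>p. X \<subseteq> {1..n} \<longrightarrow> p permutes {1..n} \<and> p ` {1..card X} = X"
    using exists_permutes_image by simp
  then obtain \<sigma> where "\<forall>X. X \<subseteq> {1..n} \<longrightarrow> \<sigma> X permutes {1..n} \<and> \<sigma> X ` {1..card X} = X"
    by (rule choice[THEN exE])
  then have \<sigma>: "\<And>X. X \<subseteq> {1..n} \<Longrightarrow> \<sigma> X permutes {1..n}"
    and \<sigma>X: "\<And>X. X \<subseteq> {1..n} \<Longrightarrow> \<sigma> X ` {1..card X} = X" by blast+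
  define s s' :: "nat set \<Rightarrow> rook \<Rightarrow>\<^sub>0 'a"
    where "s X = pmon (\<sigma> X)" and "s' X = pmon (inv (\<sigma> X))" for X
  have ss: "s X * s' X = 1" "s' X * s X = 1" if "X \<subseteq> {1..n}" for X
    unfolding s_def s'_def by (rule rook.T_inv[OF \<sigma>[OF that]])+
  have s_in: "s X * a \<in> ?L" "a * s X \<in> ?L" "s' X * a \<in> ?L" "a * s' X \<in> ?L"
    if "X \<subseteq> {1..n}" "a \<in> ?L" for X a
    unfolding s_def s'_def
    using pmon_mult_rook_alg[OF \<sigma>[OF that(1)] that(2)]
      pmon_mult_rook_alg[OF permutes_inv[OF \<sigma>[OF that(1)]] that(2)] by auto
  have fin: "finite X" if "X \<subseteq> {1..n}" for X using that by (rule finite_subset) simp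
  have k: "card X \<le> n" if "X \<subseteq> {1..n}" for X using card_mono[OF _ that] by simp
  have sN: "s X * N (card X) = moebius X * s X" if "X \<subseteq> {1..n}" for X
  proof -
    have "s X * N (card X) = moebius (\<sigma> X ` {1..card X}) * s X"
      unfolding s_def N_def by (rule perm_moebius[OF permutes_inj[OF \<sigma>[OF that]]]) simp
    then show ?thesis unfolding \<sigma>X[OF that] .
  qed
  define h where "h = (\<lambda>(X, t). s X * N (card X) * t * s' X)"
  define P where "P = (SIGMA X:Pow {1..n}. F (card X))"
  have finF: "finite (F k)" for k using F[of k] by (simp add: rook.split_family_def)
  have finP: "finite P" unfolding P_def using finF by (intro finite_SigmaI) auto
  have N_in: "N (card X) \<in> ?L" if "X \<subseteq> {1..n}" for X
    unfolding N_def using k[OF that] by (intro moebius_in_rook_alg) auto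
  have sandwich: "(s X * u * s' X) * (s X * v * s' Y) = s X * (u * v) * s' Y" if "X \<subseteq> {1..n}" for X Y u v
  proof -
    have "(s X * u * s' X) * (s X * v * s' Y) = s X * u * (s' X * s X) * v * s' Y" by (simp only: mult.assoc)
    then show ?thesis using ss(2)[OF that] by (simp add: mult.assoc)
  qed
  have h_eq: "h (X, t) = s X * (N (card X) * t) * s' X" for X t by (simp add: h_def mult.assoc)
  have N_idem: "(N (card X) * u) * (N (card X) * v) = N (card X) * (u * v)" if "u \<in> ?G (card X)" for X u v
  proof -
    have "(N (card X) * u) * (N (card X) * v) = N (card X) * (u * N (card X)) * v" by (simp only: mult.assoc)
    also have "\<dots> = (N (card X) * N (card X)) * (u * v)" unfolding Nc[OF that] by (simp only: mult.assoc)
    finally show ?thesis by (simp only: NN)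
  qed
  have h_in: "h (X, t) \<in> ?L" if "X \<subseteq> {1..n}" "t \<in> F (card X)" for X t
    unfolding h_eq using that FD(1)[OF that(2)] k[OF that(1)]
    by (intro s_in rook_alg_mult_group_alg[OF N_in]) auto
  have h_idem: "h (X, t) * h (X, t') = (if t = t' then h (X, t) else 0)"
    if "X \<subseteq> {1..n}" "t \<in> F (card X)" "t' \<in> F (card X)" for X t t'
    unfolding h_eq sandwich[OF that(1)] N_idem[OF FD(1)[OF that(2)]]
    using FD(3)[OF that(2)] FD(4)[OF that(2,3)] by auto
  have h_left: "h (X, t) = moebius X * h (X, t)" if "X \<subseteq> {1..n}" for X t
  proof -
    have "moebius X * h (X, t) = (moebius X * moebius X) * s X * t * s' X"
      unfolding h_eq using sN[OF that] by (simp only: mult.assoc[symmetric])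
    then show ?thesis using sN[OF that] fin[OF that]
      by (simp add: h_eq moebius_mult mult.assoc[symmetric])
  qed
  have h_right: "h (X, t) = h (X, t) * moebius X" if "X \<subseteq> {1..n}" "t \<in> F (card X)" for X t
  proof -
    have "s' X * moebius X = s' X * (moebius X * s X) * s' X" using ss(1)[OF that(1)] by (simp add: mult.assoc)
    also have "\<dots> = N (card X) * s' X"
      unfolding sN[OF that(1), symmetric] using ss(2)[OF that(1)] by (simp add: mult.assoc[symmetric])
    finally have "h (X, t) * moebius X = s X * N (card X) * (t * N (card X)) * s' X"
      by (simp add: h_eq mult.assoc)
    also have "\<dots> = s X * (N (card X) * N (card X)) * t * s' X"
      unfolding Nc[OF FD(1)[OF that(2)]] by (simp only: mult.assoc)
    finally show ?thesis by (simp add: NN h_eq mult.assoc)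
  qed
  have h_orth: "h x * h y = 0" if "x \<in> P" "y \<in> P" "x \<noteq> y" for x y
  proof -
    obtain X t Y t' where xy: "x = (X, t)" "y = (Y, t')" by (cases x; cases y)
    with that have X: "X \<subseteq> {1..n}" "t \<in> F (card X)" "Y \<subseteq> {1..n}" "t' \<in> F (card Y)" by (auto simp: P_def)
    show ?thesis
    proof (cases "X = Y")
      case True
      then show ?thesis using h_idem[OF X(1,2)] X xy that(3) by auto
    next
      case False
      have "h x * h y = h x * (moebius X * moebius Y) * h y"
        using h_right[OF X(1,2)] h_left[OF X(3), of t'] xy by (metis mult.assoc)
      then show ?thesis using False fin X by (simp add: moebius_mult)
    qed
  qed
  \<comment> \<open>Conjugation moves both ends to standard corners, where
    \<open>moebius_corner\<close> leaves an element of one group algebra, or 0 if the sizes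
    differ.\<close>
  have h_corner: "\<exists>c\<in>?G (card X). h (X, t) * a * h (Y, t') =
      (if card X = card Y then s X * (N (card X) * (t * c * t')) * s' Y else 0)"
    if X: "X \<subseteq> {1..n}" "t \<in> F (card X)" "Y \<subseteq> {1..n}" "t' \<in> F (card Y)" and a: "a \<in> ?L" for X t Y t' a
  proof -
    have "s' X * a * s Y \<in> ?L" by (intro s_in X a)
    then obtain c where c: "c \<in> ?G (card X)" "N (card X) * (s' X * a * s Y) * N (card Y) =
        (if card X = card Y then N (card X) * c else 0)"
      unfolding N_def using moebius_corner by blast
    have "h (X, t) * a * h (Y, t') = s X * (N (card X) * t) * (s' X * a * s Y) * N (card Y) * t' * s' Y"
      by (simp only: h_eq mult.assoc)
    also have "\<dots> = s X * t * (N (card X) * (s' X * a * s Y) * N (card Y)) * t' * s' Y"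
      unfolding Nc[OF FD(1)[OF X(2)], symmetric] by (simp only: mult.assoc)
    also have "\<dots> = (if card X = card Y then s X * (t * N (card X)) * (c * t') * s' Y else 0)"
      unfolding c(2) by (simp add: mult.assoc)
    also have "\<dots> = (if card X = card Y then s X * (N (card X) * (t * c * t')) * s' Y else 0)"
      unfolding Nc[OF FD(1)[OF X(2)]] by (simp add: mult.assoc)
    finally show ?thesis using c(1) by blast
  qed
  \<comment> \<open>Removing 0 spares a proof that \<open>N k * t\<close> is nonzero and affects
    neither the sum nor orthogonality.\<close>
  define E where "E = h ` P - {0}"
  have EE: "\<exists>X t. X \<subseteq> {1..n} \<and> t \<in> F (card X) \<and> e = h (X, t)" if "e \<in> E" for e
    using that by (auto simp: E_def P_def)
  have "rook.split_family ?L E"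
    unfolding rook.split_family_def
  proof (intro conjI ballI impI)
    show "finite E" using finP by (simp add: E_def)
    show "E \<subseteq> ?L" using h_in by (auto simp: E_def P_def)
    show "0 \<notin> E" by (simp add: E_def)
    show "e * e = e" if "e \<in> E" for e using EE[OF that] h_idem by force
    show "e * g = 0" if "e \<in> E" "g \<in> E" "e \<noteq> g" for e g
    proof -
      from that obtain x y where "x \<in> P" "y \<in> P" "e = h x" "g = h y" by (auto simp: E_def)
      then show ?thesis using h_orth[of x y] that(3) by blast
    qed
    show "\<exists>c. e * a * e = c *\<^sub>r e" if "e \<in> E" "a \<in> ?L" for e a
    proof -
      from EE[OF that(1)] obtain X t where X: "X \<subseteq> {1..n}" "t \<in> F (card X)" "e = h (X, t)" by blast
      from h_corner[OF X(1,2) X(1,2) that(2)] obtain b where b: "b \<in> ?G (card X)"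
        "e * a * e = s X * (N (card X) * (t * b * t)) * s' X" by (auto simp: X(3))
      obtain c where "t * b * t = c *\<^sub>r t" using FD(5)[OF X(2) b(1)] by blast
      then have "e * a * e = c *\<^sub>r e" using b(2) by (simp add: X(3) h_eq)
      then show ?thesis ..
    qed
  qed
  moreover have "rook.corner_semiprime ?L E"
    unfolding rook.corner_semiprime_def
  proof (intro ballI impI)
    fix e g a assume e: "e \<in> E" "g \<in> E" and a: "a \<in> ?L" and nz: "e * a * g \<noteq> 0"
    obtain X t where X: "X \<subseteq> {1..n}" "t \<in> F (card X)" "e = h (X, t)" using EE[OF e(1)] by blast
    obtain Y t' where Y: "Y \<subseteq> {1..n}" "t' \<in> F (card Y)" "g = h (Y, t')" using EE[OF e(2)] by blast
    obtain c where c: "c \<in> ?G (card X)" "card X = card Y"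
      "e * a * g = s X * (N (card X) * (t * c * t')) * s' Y"
      using h_corner[OF X(1,2) Y(1,2) a] nz unfolding X(3) Y(3) by (auto split: if_splits)
    define w where "w = N (card X) * (t * c * t')"
    have tct: "t * c * t' \<in> ?G (card X)"
      using FD(1)[OF X(2)] FD(1)[OF Y(2)] c by (auto intro!: rook.subalg_mult[OF rook.subalg_group_alg])
    have u: "e * a * g = s X * w * s' Y" using c(3) by (simp add: w_def)
    have "w \<noteq> 0" using nz u by auto
    \<comment> \<open>Maschke's argument with \<open>N (card X)\<close> as the commuting idempotent;
      the element \<open>b\<close> found here is then transported to the rook algebra.\<close>
    have "\<exists>b\<in>?G (card X). w * b * w \<noteq> 0"
    proof (rule ccontr)
      assume "\<not> ?thesis"
      then have "w = 0"
        using rook.group_alg_semiprime[OF NN Nc[OF rook.T_in, symmetric] tct w_def] by blast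
      with \<open>w \<noteq> 0\<close> show False ..
    qed
    then obtain b where b: "b \<in> ?G (card X)" "w * b * w \<noteq> 0" by blast
    have wN: "w * N (card X) = w"
    proof -
      have "w * N (card X) = (N (card X) * N (card X)) * (t * c * t')"
        unfolding w_def mult.assoc[of "N (card X)" "t * c * t'"] Nc[OF tct] by (simp only: mult.assoc)
      then show ?thesis by (simp add: NN w_def)
    qed
    define r where "r = s Y * (N (card X) * b) * s' X"
    have "r \<in> ?L" unfolding r_def using X(1) Y(1) k[OF X(1)] b(1)
      by (intro s_in rook_alg_mult_group_alg[OF N_in])
    moreover have "(e * a * g) * r * (e * a * g) \<noteq> 0"
    proof
      assume 0: "(e * a * g) * r * (e * a * g) = 0"
      have "(e * a * g) * r * (e * a * g) =
         s X * (w * (s' Y * s Y) * (N (card X) * b) * (s' X * s X) * w) * s' Y"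
        unfolding u r_def by (simp only: mult.assoc)
      also have "\<dots> = s X * (w * N (card X) * b * w) * s' Y"
        using ss(2)[OF X(1)] ss(2)[OF Y(1)] by (simp add: mult.assoc)
      finally have "s' X * (s X * (w * b * w) * s' Y) * s Y = 0" using 0 wN by simp
      then have "(s' X * s X) * (w * b * w) * (s' Y * s Y) = 0" by (simp only: mult.assoc)
      then show False using b(2) ss(2)[OF X(1)] ss(2)[OF Y(1)] by simp
    qed
    ultimately show "\<exists>b\<in>?L. (e * a * g) * b * (e * a * g) \<noteq> 0" by blast
  qed
  moreover have "\<Sum>E = mon (idr {1..n})"
  proof -
    have "\<Sum>E = \<Sum>(h ` P)" unfolding E_def using finP by (intro sum.mono_neutral_left) auto
    also have "\<dots> = sum ((\<lambda>x. x) \<circ> h) P"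
    \<comment> \<open>Different indices can share a value only if it is 0, since orthogonality gives
      \<open>h x = h x * h y = 0\<close>.\<close>
    proof (rule sum.reindex_nontrivial[OF finP])
      fix x y assume xy: "x \<in> P" "y \<in> P" "x \<noteq> y" "h x = h y"
      then have "h x * h x = 0" using h_orth[of x y] by simp
      moreover have "h x * h x = h x" using xy(1) h_idem by (auto simp: P_def)
      ultimately show "h x = 0" by simp
    qed
    also have "\<dots> = (\<Sum>X\<in>Pow {1..n}. \<Sum>t\<in>F (card X). h (X, t))"
      unfolding P_def using finF by (subst sum.Sigma) auto
    also have "\<dots> = (\<Sum>X\<in>Pow {1..n}. moebius X)"
    proof (rule sum.cong[OF refl])
      fix X assume "X \<in> Pow {1..n}"
      then have X: "X \<subseteq> {1..n}" by simp
      have "(\<Sum>t\<in>F (card X). h (X, t)) = s X * (N (card X) * \<Sum>(F (card X))) * s' X"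
        unfolding h_eq by (simp add: sum_distrib_left sum_distrib_right)
      also have "\<dots> = moebius X * (s X * s' X)" by (simp add: sumF sN[OF X] mult.assoc)
      finally show "(\<Sum>t\<in>F (card X). h (X, t)) = moebius X" by (simp add: ss[OF X])
    qed
    also have "\<dots> = mon (idr {1..n})" by (intro sum_moebius) simp
    finally show ?thesis .
  qed
  ultimately show ?thesis by blast
qed

section \<open>Diagrams as partial injections\<close>

text \<open>Pairs run from top to bottom, so stacking diagrams becomes relational
  composition.\<close>

definition diag_rel :: "diagram \<Rightarrow> (nat \<times> nat) set" where
  "diag_rel D = {(i, j). {Top i, Bot j} \<in> D}"

definition rel_diag :: "(nat \<times> nat) set \<Rightarrow> diagram" where
  "rel_diag r = {{Top i, Bot j} |i j. (i, j) \<in> r}"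

lemma Top_Bot_eq_iff: "{Top i, Bot j} = {Top i', Bot j'} \<longleftrightarrow> i = i' \<and> j = j'"
  by (auto simp: doubleton_eq_iff)

lemma diag_rel_rel_diag [simp]: "diag_rel (rel_diag r) = r"
  by (auto simp: diag_rel_def rel_diag_def Top_Bot_eq_iff)

lemma vertices_simps [simp]:
  "Top i \<in> vertices n \<longleftrightarrow> i \<in> {1..n}" "Bot i \<in> vertices n \<longleftrightarrow> i \<in> {1..n}"
  by (auto simp: vertices_def)

text \<open>\<open>degree\<close> is a cardinality and would be 0 on an infinite set; finiteness is
  what turns the degree bound into uniqueness of the edge.\<close>

lemma finite_edges_at:
  assumes "D \<in> diagrams n"
  shows "finite {e \<in> D. v \<in> e}"
proof -
  have "D \<subseteq> Pow (vertices n)" using assms by (fastforce simp: diagrams_def)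
  moreover have "finite (vertices n)" by (simp add: vertices_def)
  ultimately show ?thesis by (metis (no_types, lifting) finite_Pow_iff finite_subset mem_Collect_eq subsetI)
qed

lemma Ln_basisD:
  assumes "D \<in> Ln_basis n"
  shows "rel_diag (diag_rel D) = D" "diag_rel D \<subseteq> {1..n} \<times> {1..n}"
    "single_valued (diag_rel D)" "single_valued ((diag_rel D)\<inverse>)"
proof -
  have D: "D \<in> diagrams n" and nh: "\<And>e. e \<in> D \<Longrightarrow> \<not> is_horizontal e"
    using assms by (auto simp: Ln_basis_def)
  have edge: "\<exists>i j. i \<in> {1..n} \<and> j \<in> {1..n} \<and> e = {Top i, Bot j}" if e: "e \<in> D" for e
  proof -
    have "\<exists>u v. u \<noteq> v \<and> u \<in> vertices n \<and> v \<in> vertices n \<and> e = {u, v}"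
      using D e unfolding diagrams_def by simp
    then obtain u v where uv: "u \<in> vertices n" "v \<in> vertices n" "e = {u, v}" by (elim exE conjE)
    have hor: "is_horizontal {Top i, Top j}" "is_horizontal {Bot i, Bot j}" for i j
      unfolding is_horizontal_def by blast+
    show ?thesis
    proof (cases u; cases v)
      fix i j assume "u = Top i" "v = Bot j"
      then have "i \<in> {1..n} \<and> j \<in> {1..n} \<and> e = {Top i, Bot j}" using uv by simp
      then show ?thesis by blast
    next
      fix i j assume "u = Bot j" "v = Top i"
      then have "i \<in> {1..n} \<and> j \<in> {1..n} \<and> e = {Top i, Bot j}" using uv by (simp add: insert_commute)
      then show ?thesis by blast
    next
      fix i j assume "u = Top i" "v = Top j"
      then show ?thesis using nh[OF e] uv hor(1) by simp
    next
      fix i j assume "u = Bot i" "v = Bot j"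
      then show ?thesis using nh[OF e] uv hor(2) by simp
    qed
  qed
  show "rel_diag (diag_rel D) = D"
  proof (intro equalityI subsetI)
    fix e assume "e \<in> D"
    from edge[OF this] obtain i j where "e = {Top i, Bot j}" by blast
    with \<open>e \<in> D\<close> show "e \<in> rel_diag (diag_rel D)" unfolding rel_diag_def diag_rel_def by blast
  next
    fix e assume "e \<in> rel_diag (diag_rel D)"
    then show "e \<in> D" unfolding rel_diag_def diag_rel_def by blast
  qed
  show sub: "diag_rel D \<subseteq> {1..n} \<times> {1..n}"
  proof (rule subrelI)
    fix i j assume "(i, j) \<in> diag_rel D"
    then have "{Top i, Bot j} \<in> D" by (simp add: diag_rel_def)
    from edge[OF this] obtain i' j' where "i' \<in> {1..n}" "j' \<in> {1..n}" "{Top i, Bot j} = {Top i', Bot j'}" by blast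
    then show "(i, j) \<in> {1..n} \<times> {1..n}" unfolding Top_Bot_eq_iff by blast
  qed
  have uniq: "e = e'" if "e \<in> D" "e' \<in> D" "v \<in> e" "v \<in> e'" "v \<in> vertices n" for e e' v
  proof -
    have "card {e \<in> D. v \<in> e} \<le> Suc 0" using D that(5) by (simp add: diagrams_def Defs.degree_def)
    then show ?thesis using that finite_edges_at[OF D] by (simp add: card_le_Suc0_iff_eq)
  qed
  show "single_valued (diag_rel D)"
  proof (rule single_valuedI)
    fix i j j' assume ij: "(i, j) \<in> diag_rel D" "(i, j') \<in> diag_rel D"
    then have "i \<in> {1..n}" using sub by auto
    with ij uniq[of "{Top i, Bot j}" "{Top i, Bot j'}" "Top i"] show "j = j'"
      by (simp add: diag_rel_def Top_Bot_eq_iff)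
  qed
  show "single_valued ((diag_rel D)\<inverse>)"
  proof (rule single_valuedI)
    fix j i i' assume ij: "(j, i) \<in> (diag_rel D)\<inverse>" "(j, i') \<in> (diag_rel D)\<inverse>"
    then have "j \<in> {1..n}" using sub by auto
    with ij uniq[of "{Top i, Bot j}" "{Top i', Bot j}" "Bot j"] show "i = i'"
      by (simp add: diag_rel_def Top_Bot_eq_iff)
  qed
qed

lemma rel_diag_in_Ln_basis:
  assumes r: "r \<subseteq> {1..n} \<times> {1..n}" "single_valued r" "single_valued (r\<inverse>)"
  shows "rel_diag r \<in> Ln_basis n"
proof -
  have "\<exists>u v. u \<noteq> v \<and> u \<in> vertices n \<and> v \<in> vertices n \<and> e = {u, v}" if "e \<in> rel_diag r" for e
  proof -
    from that obtain i j where "(i, j) \<in> r" "e = {Top i, Bot j}" by (auto simp: rel_diag_def)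
    then show ?thesis using r(1) by (intro exI[of _ "Top i"] exI[of _ "Bot j"]) auto
  qed
  moreover have "Defs.degree (rel_diag r) v \<le> 1" for v
  proof -
    have "\<exists>e. {e \<in> rel_diag r. v \<in> e} \<subseteq> {e}"
    proof (cases v)
      case (Top i)
      have "{e \<in> rel_diag r. v \<in> e} \<subseteq> {{Top i, Bot (THE j. (i, j) \<in> r)}}"
      proof
        fix e assume "e \<in> {e \<in> rel_diag r. v \<in> e}"
        then obtain j where "(i, j) \<in> r" "e = {Top i, Bot j}" using Top by (auto simp: rel_diag_def)
        moreover from this have "(THE j. (i, j) \<in> r) = j"
          using r(2) by (intro the_equality) (auto dest: single_valuedD)
        ultimately show "e \<in> {{Top i, Bot (THE j. (i, j) \<in> r)}}" by simp
      qed
      then show ?thesis by blast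
    next
      case (Bot j)
      have "{e \<in> rel_diag r. v \<in> e} \<subseteq> {{Top (THE i. (i, j) \<in> r), Bot j}}"
      proof
        fix e assume "e \<in> {e \<in> rel_diag r. v \<in> e}"
        then obtain i where "(i, j) \<in> r" "e = {Top i, Bot j}" using Bot by (auto simp: rel_diag_def)
        moreover from this have "(THE i. (i, j) \<in> r) = i"
          using r(3) by (intro the_equality) (auto dest: single_valuedD)
        ultimately show "e \<in> {{Top (THE i. (i, j) \<in> r), Bot j}}" by simp
      qed
      then show ?thesis by blast
    qed
    then obtain e where "{e \<in> rel_diag r. v \<in> e} \<subseteq> {e}" by blast
    then have "card {e \<in> rel_diag r. v \<in> e} \<le> card {e}" by (intro card_mono) auto
    then show ?thesis by (simp add: Defs.degree_def)
  qed
  moreover have "\<not> is_horizontal e" if "e \<in> rel_diag r" for e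
    using that by (auto simp: rel_diag_def is_horizontal_def doubleton_eq_iff)
  ultimately show ?thesis by (simp add: Ln_basis_def diagrams_def)
qed

lemma finite_Ln_basis: "finite (Ln_basis n)"
proof (rule finite_subset)
  show "Ln_basis n \<subseteq> rel_diag ` Pow ({1..n} \<times> {1..n})"
  proof
    fix D assume "D \<in> Ln_basis n"
    from Ln_basisD(1,2)[OF this] show "D \<in> rel_diag ` Pow ({1..n} \<times> {1..n})"
      by (metis PowI image_eqI)
  qed
qed auto

text \<open>A label of the connected component of a vertex of the stacked graph: its middle vertex if
  there is one.\<close>

fun component :: "(nat \<times> nat) set \<Rightarrow> (nat \<times> nat) set \<Rightarrow> svtx \<Rightarrow> svtx" where
  "component r q (Mid j) = Mid j"
| "component r q (Up i) = (if \<exists>j. (i, j) \<in> r then Mid (THE j. (i, j) \<in> r) else Up i)"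
| "component r q (Down k) = (if \<exists>j. (j, k) \<in> q then Mid (THE j. (j, k) \<in> q) else Down k)"

lemma component_Up: "single_valued r \<Longrightarrow> (i, j) \<in> r \<Longrightarrow> component r q (Up i) = Mid j"
  by (auto dest: single_valuedD intro!: the_equality)

lemma component_Down: "single_valued (q\<inverse>) \<Longrightarrow> (j, k) \<in> q \<Longrightarrow> component r q (Down k) = Mid j"
  by (auto dest: single_valuedD intro!: the_equality)

section \<open>Connected components of stacked diagrams\<close>

lemma doubleton_in_rel_diag:
  "{v, w} \<in> rel_diag r \<longleftrightarrow> (\<exists>i j. (i, j) \<in> r \<and> (v = Top i \<and> w = Bot j \<or> v = Bot j \<and> w = Top i))"
  unfolding rel_diag_def mem_Collect_eq doubleton_eq_iff by blast

lemma stack_edges_rel_diag: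
  "stack_edges (rel_diag r) (rel_diag q) =
     {(Up i, Mid j) |i j. (i, j) \<in> r} \<union> {(Mid j, Up i) |i j. (i, j) \<in> r} \<union>
     {(Mid j, Down k) |j k. (j, k) \<in> q} \<union> {(Down k, Mid j) |j k. (j, k) \<in> q}"
proof -
  have edges: "{(u, w). \<exists>e\<in>rel_diag r. \<exists>p q. e = {p, q} \<and> u = f p \<and> w = f q} =
     {(f (Top i), f (Bot j)) |i j. (i, j) \<in> r} \<union> {(f (Bot j), f (Top i)) |i j. (i, j) \<in> r}"
    for r and f :: "vtx \<Rightarrow> svtx"
  proof -
    have "{(u, w). \<exists>e\<in>rel_diag r. \<exists>p q. e = {p, q} \<and> u = f p \<and> w = f q} =
       {(f p, f q) |p q. {p, q} \<in> rel_diag r}" by blast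
    also have "\<dots> = {(f (Top i), f (Bot j)) |i j. (i, j) \<in> r} \<union> {(f (Bot j), f (Top i)) |i j. (i, j) \<in> r}"
      unfolding doubleton_in_rel_diag by blast
    finally show ?thesis .
  qed
  show ?thesis unfolding stack_edges_def edges by (simp add: upper_def lower_def Un_assoc)
qed

text \<open>The label is constant along edges, and every vertex is connected to its own
  label.\<close>

lemma connected_st_rel_diag:
  assumes r: "single_valued r" and q: "single_valued (q\<inverse>)"
  shows "connected_st (rel_diag r) (rel_diag q) u w \<longleftrightarrow> component r q u = component r q w"
proof -
  let ?S = "stack_edges (rel_diag r) (rel_diag q)"
  have "component r q u = component r q w" if "(u, w) \<in> ?S\<^sup>*"
    using that
  proof (induction rule: rtrancl_induct)
    case (step v w)
    have "component r q v = component r q w" using step(2) unfolding stack_edges_rel_diag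
      using component_Up[OF r] component_Down[OF q] by auto
    then show ?case using step(3) by simp
  qed simp
  moreover have to_component: "(u, component r q u) \<in> ?S\<^sup>* \<and> (component r q u, u) \<in> ?S\<^sup>*" for u
  proof (cases u)
    case (Up i)
    show ?thesis
    proof (cases "\<exists>j. (i, j) \<in> r")
      case True
      then obtain j where j: "(i, j) \<in> r" by blast
      then have "(Up i, Mid j) \<in> ?S" "(Mid j, Up i) \<in> ?S" unfolding stack_edges_rel_diag by auto
      then show ?thesis using Up component_Up[OF r j] by auto
    qed (simp add: Up)
  next
    case (Down k)
    show ?thesis
    proof (cases "\<exists>j. (j, k) \<in> q")
      case True
      then obtain j where j: "(j, k) \<in> q" by blast
      then have "(Down k, Mid j) \<in> ?S" "(Mid j, Down k) \<in> ?S" unfolding stack_edges_rel_diag by auto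
      then show ?thesis using Down component_Down[OF q j] by auto
    qed (simp add: Down)
  qed simp
  then have "(u, w) \<in> ?S\<^sup>*" if "component r q u = component r q w"
    using that by (metis rtrancl_trans)
  ultimately show ?thesis unfolding connected_st_def by blast
qed

lemma component_Up_eq_Mid:
  assumes "single_valued r" "component r q (Up i) = Mid j" shows "(i, j) \<in> r"
  using assms component_Up[OF assms(1)] by (cases "\<exists>j. (i, j) \<in> r") fastforce+

lemma component_Down_eq_Mid:
  assumes "single_valued (q\<inverse>)" "component r q (Down k) = Mid j" shows "(j, k) \<in> q"
  using assms component_Down[OF assms(1)] by (cases "\<exists>j. (j, k) \<in> q") fastforce+

lemma component_Up_inj:
  assumes "single_valued r" "single_valued (r\<inverse>)" "component r q (Up i) = component r q (Up i')"
  shows "i = i'"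
proof (cases "\<exists>j. (i, j) \<in> r")
  case True
  then obtain j where j: "(i, j) \<in> r" by blast
  then have "(i', j) \<in> r" using assms component_Up[OF assms(1) j] by (metis component_Up_eq_Mid)
  then show ?thesis using j assms(2) by (meson converseI single_valuedD)
next
  case False
  then show ?thesis using assms(3) by (simp split: if_splits)
qed

lemma component_Down_inj:
  assumes "single_valued q" "single_valued (q\<inverse>)" "component r q (Down i) = component r q (Down i')"
  shows "i = i'"
proof (cases "\<exists>j. (j, i) \<in> q")
  case True
  then obtain j where j: "(j, i) \<in> q" by blast
  then have "(j, i') \<in> q" using assms component_Down[OF assms(2) j] by (metis component_Down_eq_Mid)
  then show ?thesis using j assms(1) by (meson single_valuedD)
next
  case False
  then show ?thesis using assms(3) by (simp split: if_splits)
qed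

lemma component_Up_Down:
  assumes "single_valued r" "single_valued (q\<inverse>)"
  shows "component r q (Up i) = component r q (Down k) \<longleftrightarrow> (i, k) \<in> r O q"
proof
  assume eq: "component r q (Up i) = component r q (Down k)"
  then have "\<exists>j. component r q (Up i) = Mid j" by (auto split: if_splits)
  then obtain j where "component r q (Up i) = Mid j" by blast
  then show "(i, k) \<in> r O q"
    using component_Up_eq_Mid[OF assms(1)] component_Down_eq_Mid[OF assms(2)] eq by (metis relcompI)
next
  assume "(i, k) \<in> r O q"
  then obtain j where "(i, j) \<in> r" "(j, k) \<in> q" by blast
  then show "component r q (Up i) = component r q (Down k)"
    using component_Up[OF assms(1)] component_Down[OF assms(2)] by metis
qed

text \<open>Injectivity forbids a path between two distinct vertices of the same outer row, so only
  vertical arcs arise, and they compose as relations.\<close>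

lemma Gprime_rel_diag:
  assumes r: "r \<subseteq> {1..n} \<times> {1..n}" "single_valued r" "single_valued (r\<inverse>)"
    and q: "q \<subseteq> {1..n} \<times> {1..n}" "single_valued q" "single_valued (q\<inverse>)"
  shows "Gprime n (rel_diag r) (rel_diag q) = rel_diag (r O q)"
proof (intro equalityI subsetI)
  fix e assume "e \<in> Gprime n (rel_diag r) (rel_diag q)"
  then obtain p p' u w where e: "e = {p, p'}" "u \<noteq> w" "outer n u = Some p" "outer n w = Some p'"
    "component r q u = component r q w"
    unfolding Gprime_def connected_st_rel_diag[OF r(2) q(3)] by blast
  have out: "(\<exists>i. u = Up i \<and> p = Top i) \<or> (\<exists>i. u = Down i \<and> p = Bot i)" if "outer n u = Some p" for u p
    using that by (cases u) (auto simp: outer_def split: if_splits)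
  from out[OF e(3)] out[OF e(4)] show "e \<in> rel_diag (r O q)"
  proof (elim disjE exE conjE)
    fix i k assume "u = Up i" "p = Top i" "w = Down k" "p' = Bot k"
    then show ?thesis using e component_Up_Down[OF r(2) q(3)] by (auto simp: rel_diag_def)
  next
    fix i k assume "u = Down k" "p = Bot k" "w = Up i" "p' = Top i"
    then show ?thesis using e component_Up_Down[OF r(2) q(3), of i k]
      by (auto simp: rel_diag_def insert_commute)
  qed (use e component_Up_inj[OF r(2,3)] component_Down_inj[OF q(2,3)] in blast)+
next
  fix e assume "e \<in> rel_diag (r O q)"
  then obtain i k where ik: "e = {Top i, Bot k}" "(i, k) \<in> r O q" by (auto simp: rel_diag_def)
  then have "component r q (Up i) = component r q (Down k)" using component_Up_Down[OF r(2) q(3)] by blast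
  moreover have "outer n (Up i) = Some (Top i)" "outer n (Down k) = Some (Bot k)"
    using ik(2) r(1) q(1) by (auto simp: outer_def)
  ultimately show "e \<in> Gprime n (rel_diag r) (rel_diag q)"
    unfolding Gprime_def connected_st_rel_diag[OF r(2) q(3)] using ik(1) by blast
qed

text \<open>A middle vertex met by \<open>r\<close> or \<open>q\<close> is joined to an outer row;
  any other is isolated. The counted components are therefore singletons.\<close>

lemma ell_rel_diag:
  assumes r: "single_valued r" and q: "single_valued (q\<inverse>)"
  shows "ell n (rel_diag r) (rel_diag q) = card ({1..n} - (Range r \<union> Domain q))"
proof -
  have C: "(\<forall>w\<in>{w. component r q (Mid j) = component r q w}. \<exists>m. w = Mid m) \<longleftrightarrow> j \<notin> Range r \<union> Domain q" for j
  proof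
    assume all: "\<forall>w\<in>{w. component r q (Mid j) = component r q w}. \<exists>m. w = Mid m"
    show "j \<notin> Range r \<union> Domain q"
    proof
      assume "j \<in> Range r \<union> Domain q"
      then consider i where "(i, j) \<in> r" | k where "(j, k) \<in> q" by blast
      then show False
      proof cases
        case 1
        then have "component r q (Mid j) = component r q (Up i)" using component_Up[OF r] by simp
        then show False using all by blast
      next
        case 2
        then have "component r q (Mid j) = component r q (Down k)" using component_Down[OF q] by simp
        then show False using all by blast
      qed
    qed
  next
    assume j: "j \<notin> Range r \<union> Domain q"
    show "\<forall>w\<in>{w. component r q (Mid j) = component r q w}. \<exists>m. w = Mid m"
    proof
      fix w assume "w \<in> {w. component r q (Mid j) = component r q w}"
      then have w: "component r q w = Mid j" by simp
      show "\<exists>m. w = Mid m"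
        using j w component_Up_eq_Mid[OF r] component_Down_eq_Mid[OF q] by (cases w) blast+
    qed
  qed
  have single: "{w. component r q (Mid j) = component r q w} = {Mid j}" if "j \<notin> Range r \<union> Domain q" for j
  proof (intro equalityI subsetI)
    fix w assume w: "w \<in> {w. component r q (Mid j) = component r q w}"
    moreover have "\<forall>w\<in>{w. component r q (Mid j) = component r q w}. \<exists>m. w = Mid m" using C[of j] that by (rule iffD2)
    ultimately obtain m where "w = Mid m" by blast
    with w show "w \<in> {Mid j}" by simp
  qed simp
  have "{C. \<exists>j\<in>{1..n}. C = {w. component r q (Mid j) = component r q w} \<and> (\<forall>w\<in>C. \<exists>m. w = Mid m)} =
     (\<lambda>j. {Mid j}) ` ({1..n} - (Range r \<union> Domain q))"
  proof (intro equalityI subsetI)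
    fix K assume "K \<in> {C. \<exists>j\<in>{1..n}. C = {w. component r q (Mid j) = component r q w} \<and> (\<forall>w\<in>C. \<exists>m. w = Mid m)}"
    then obtain j where "j \<in> {1..n}" "K = {w. component r q (Mid j) = component r q w}" "j \<notin> Range r \<union> Domain q"
      using C by blast
    then show "K \<in> (\<lambda>j. {Mid j}) ` ({1..n} - (Range r \<union> Domain q))" using single by blast
  next
    fix K assume "K \<in> (\<lambda>j. {Mid j}) ` ({1..n} - (Range r \<union> Domain q))"
    then obtain j where j: "j \<in> {1..n}" "j \<notin> Range r \<union> Domain q" "K = {Mid j}" by blast
    then have "K = {w. component r q (Mid j) = component r q w}" using single by metis
    then show "K \<in> {C. \<exists>j\<in>{1..n}. C = {w. component r q (Mid j) = component r q w} \<and> (\<forall>w\<in>C. \<exists>m. w = Mid m)}"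
      using j by blast
  qed
  then have "ell n (rel_diag r) (rel_diag q) = card ((\<lambda>j. {Mid j}) ` ({1..n} - (Range r \<union> Domain q)))"
    unfolding ell_def connected_st_rel_diag[OF r q] by (simp only:)
  also have "\<dots> = card ({1..n} - (Range r \<union> Domain q))" by (intro card_image) (auto simp: inj_on_def)
  finally show ?thesis .
qed

section \<open>Loops and ranks\<close>

lemma card_Domain_single_valued: "single_valued r \<Longrightarrow> card (Domain r) = card r"
  unfolding Domain_fst by (intro card_image) (auto simp: inj_on_def dest: single_valuedD)

lemma card_Range_single_valued: "single_valued (r\<inverse>) \<Longrightarrow> card (Range r) = card r"
  unfolding Range_snd by (intro card_image) (auto simp: inj_on_def dest: single_valuedD)

text \<open>Inclusion-exclusion for \<open>Range r\<close> and \<open>Domain q\<close>: the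
  complement of their union counts the loops, their intersection has the size of the composite. In
  this form the corank \<open>n - card r\<close> is additive up to the loop exponent.\<close>

lemma ell_rank:
  assumes r: "r \<subseteq> {1..n} \<times> {1..n}" "single_valued r" "single_valued (r\<inverse>)"
    and q: "q \<subseteq> {1..n} \<times> {1..n}" "single_valued q" "single_valued (q\<inverse>)"
  shows "ell n (rel_diag r) (rel_diag q) + (n - card (r O q)) = (n - card r) + (n - card q)"
proof -
  have R: "Range r \<subseteq> {1..n}" and D: "Domain q \<subseteq> {1..n}" using r(1) q(1) by auto
  then have fin: "finite (Range r)" "finite (Domain q)" by (meson finite_atLeastAtMost finite_subset)+
  \<comment> \<open>The part of \<open>q\<close> reached through \<open>r\<close>; it has the range
    of \<open>r O q\<close>, and its domain is the intersection to be counted.\<close>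
  define q' where "q' = {(j, k). (j, k) \<in> q \<and> j \<in> Range r}"
  have q': "single_valued q'" "single_valued (q'\<inverse>)"
    using q(2,3) unfolding q'_def single_valued_def by blast+
  have rq: "single_valued ((r O q)\<inverse>)"
    unfolding converse_relcomp by (rule single_valued_relcomp[OF q(3) r(3)])
  have "Range q' = Range (r O q)" "Domain q' = Range r \<inter> Domain q" unfolding q'_def by blast+
  then have rank: "card (r O q) = card (Range r \<inter> Domain q)"
    using card_Range_single_valued[OF rq] card_Range_single_valued[OF q'(2)] card_Domain_single_valued[OF q'(1)]
    by simp
  have "card (Range r \<union> Domain q) + card (r O q) = card r + card q"
    using card_Un_Int[OF fin] rank card_Range_single_valued[OF r(3)] card_Domain_single_valued[OF q(2)] by simp
  moreover have "card (Range r \<union> Domain q) \<le> n" using card_mono[of "{1..n}" "Range r \<union> Domain q"] R D by simp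
  moreover have "card r \<le> n" "card q \<le> n"
    using card_mono[of "{1..n}" "Range r"] card_mono[of "{1..n}" "Domain q"] R D
      card_Range_single_valued[OF r(3)] card_Domain_single_valued[OF q(2)] by simp_all
  moreover have "card (r O q) \<le> n" using rank card_mono[of "{1..n}" "Range r \<inter> Domain q"] R by auto
  moreover have "ell n (rel_diag r) (rel_diag q) = n - card (Range r \<union> Domain q)"
    unfolding ell_rel_diag[OF r(2) q(3)] using fin R D by (subst card_Diff_subset) auto
  ultimately show ?thesis by simp
qed

section \<open>Semisimplicity\<close>

definition diag_rook :: "diagram \<Rightarrow> rook" where
  "diag_rook D = Abs_rook (diag_rel D)"

lemma rook_rel_diag_rook: "D \<in> Ln_basis n \<Longrightarrow> rook_rel (diag_rook D) = diag_rel D"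
  unfolding diag_rook_def using Ln_basisD(3,4) by (intro Abs_rook_inverse) auto

lemma diag_rook_inj:
  assumes "D \<in> Ln_basis n" "D' \<in> Ln_basis n" "diag_rook D = diag_rook D'"
  shows "D = D'"
  using assms rook_rel_diag_rook Ln_basisD(1) by metis

lemma Gprime_Ln_basis:
  assumes a: "a \<in> Ln_basis n" and b: "b \<in> Ln_basis n"
  shows "Gprime n a b \<in> Ln_basis n" "diag_rook (Gprime n a b) = diag_rook a + diag_rook b"
    "ell n a b + (n - card (diag_rel (Gprime n a b))) = (n - card (diag_rel a)) + (n - card (diag_rel b))"
proof -
  note aD = Ln_basisD[OF a] and bD = Ln_basisD[OF b]
  have G: "Gprime n a b = rel_diag (diag_rel a O diag_rel b)"
    using Gprime_rel_diag[OF aD(2-4) bD(2-4)] by (simp add: aD(1) bD(1))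
  have "single_valued ((diag_rel a O diag_rel b)\<inverse>)"
    unfolding converse_relcomp by (rule single_valued_relcomp[OF bD(4) aD(4)])
  moreover have "diag_rel a O diag_rel b \<subseteq> {1..n} \<times> {1..n}" using aD(2) bD(2) by blast
  ultimately show G_in: "Gprime n a b \<in> Ln_basis n"
    unfolding G using single_valued_relcomp[OF aD(3) bD(3)] by (intro rel_diag_in_Ln_basis)
  show "diag_rook (Gprime n a b) = diag_rook a + diag_rook b"
    unfolding rook_rel_inject[symmetric] plus_rook.rep_eq rook_rel_diag_rook[OF a] rook_rel_diag_rook[OF b]
      rook_rel_diag_rook[OF G_in] by (simp add: G)
  show "ell n a b + (n - card (diag_rel (Gprime n a b))) = (n - card (diag_rel a)) + (n - card (diag_rel b))"
    unfolding G using ell_rank[OF aD(2-4) bD(2-4)] by (simp add: aD(1) bD(1))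
qed

text \<open>Rescaling a diagram of rank \<open>k\<close> by \<open>x\<close> to the power \<open>n - k\<close> absorbs the loop factor.\<close>

definition to_rook :: "'a::field \<Rightarrow> nat \<Rightarrow> (diagram \<Rightarrow> 'a) \<Rightarrow> (rook \<Rightarrow>\<^sub>0 'a)" where
  "to_rook x n f = (\<Sum>D\<in>Ln_basis n. (f D * x ^ (n - card (diag_rel D))) *\<^sub>r mon (diag_rook D))"

lemma to_rook_add: "to_rook x n (\<lambda>D. f D + g D) = to_rook x n f + to_rook x n g"
  by (simp add: to_rook_def distrib_right rook.scale_left_distrib sum.distrib)

lemma to_rook_scale: "to_rook x n (\<lambda>D. c * f D) = c *\<^sub>r to_rook x n f"
  by (simp add: to_rook_def rook.scale_sum_right mult.assoc)

lemma to_rook_mult: "to_rook x n (Ln_mult x n f g) = to_rook x n f * to_rook x n g"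
proof -
  let ?B = "Ln_basis n" and ?w = "\<lambda>D. x ^ (n - card (diag_rel D))"
  let ?t = "\<lambda>a b. (f a * ?w a * (g b * ?w b)) *\<^sub>r mon (diag_rook a + diag_rook b)"
  have "to_rook x n (Ln_mult x n f g) = (\<Sum>c\<in>?B. \<Sum>a\<in>?B. \<Sum>b\<in>?B.
      if Gprime n a b = c then (x ^ ell n a b * f a * g b * ?w c) *\<^sub>r mon (diag_rook c) else 0)"
    unfolding to_rook_def Ln_mult_def
    by (simp add: sum_distrib_right rook.scale_sum_left if_distrib[of "\<lambda>u. u * _"] if_distrib[of "\<lambda>u. u *\<^sub>r _"] cong: if_cong)
  also have "\<dots> = (\<Sum>a\<in>?B. \<Sum>b\<in>?B. \<Sum>c\<in>?B.
      if Gprime n a b = c then (x ^ ell n a b * f a * g b * ?w c) *\<^sub>r mon (diag_rook c) else 0)"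
    by (rule trans[OF sum.swap]) (rule sum.cong[OF refl], rule sum.swap)
  also have "\<dots> = (\<Sum>a\<in>?B. \<Sum>b\<in>?B. ?t a b)"
  proof (intro sum.cong refl)
    fix a b assume ab: "a \<in> ?B" "b \<in> ?B"
    let ?c = "Gprime n a b"
    note G = Gprime_Ln_basis[OF ab]
    \<comment> \<open>Additivity of coranks in the exponent of \<open>x\<close>.\<close>
    have "x ^ ell n a b * ?w ?c = ?w a * ?w b" using G(3) by (simp add: power_add[symmetric])
    then have "x ^ ell n a b * f a * g b * ?w ?c = f a * ?w a * (g b * ?w b)" by (simp add: algebra_simps)
    then show "(\<Sum>c\<in>?B. if ?c = c then (x ^ ell n a b * f a * g b * ?w c) *\<^sub>r mon (diag_rook c) else 0) = ?t a b"
      using G(1,2) finite_Ln_basis[of n] by (simp add: sum.delta')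
  qed
  also have "\<dots> = to_rook x n f * to_rook x n g"
    unfolding to_rook_def sum_product by (intro sum.cong refl) (simp add: mon_mult mult.commute)
  finally show ?thesis .
qed

lemma lookup_to_rook:
  assumes "D \<in> Ln_basis n"
  shows "Poly_Mapping.lookup (to_rook x n f) (diag_rook D) = f D * x ^ (n - card (diag_rel D))"
proof -
  have "Poly_Mapping.lookup (to_rook x n f) (diag_rook D) =
     (\<Sum>D'\<in>Ln_basis n. if D' = D then f D' * x ^ (n - card (diag_rel D')) else 0)"
    unfolding to_rook_def lookup_sum rscale_mon lookup_single
    using diag_rook_inj[OF _ assms] by (intro sum.cong refl) (auto simp: when_def)
  then show ?thesis using assms finite_Ln_basis by simp
qed

text \<open>Here \<open>x \<noteq> 0\<close> enters: the powers of \<open>x\<close> used for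
  rescaling are invertible, so coefficients can be recovered and every rook is reached.\<close>

lemma bij_betw_to_rook:
  fixes x :: "'a::field"
  assumes x: "x \<noteq> 0"
  shows "bij_betw (to_rook x n) (Ln_carrier n) (rook_alg n)"
proof (rule bij_betw_imageI)
  show "inj_on (to_rook x n) (Ln_carrier n)"
  proof (rule inj_onI)
    fix f g assume fg: "f \<in> Ln_carrier n" "g \<in> Ln_carrier n" "to_rook x n f = to_rook x n g"
    show "f = g"
    proof
      fix D
      show "f D = g D"
      proof (cases "D \<in> Ln_basis n")
        case True
        then show ?thesis using lookup_to_rook[OF True, of x] fg(3) x by (metis mult_right_cancel power_not_zero)
      next
        case False
        then show ?thesis using fg by (simp add: Ln_carrier_def)
      qed
    qed
  qed
  show "to_rook x n ` Ln_carrier n = rook_alg n"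
  proof (intro equalityI subsetI)
    fix v assume "v \<in> to_rook x n ` Ln_carrier n"
    then obtain f where "v = to_rook x n f" by blast
    moreover have "(mon (diag_rook D) :: rook \<Rightarrow>\<^sub>0 'a) \<in> rook_alg n" if "D \<in> Ln_basis n" for D
      using Ln_basisD(2)[OF that] by (intro mon_in_rook_alg) (simp add: rook_rel_diag_rook[OF that])
    ultimately show "v \<in> rook_alg n" unfolding to_rook_def
      by (auto intro!: rook.subalg_sum[OF subalg_rook_alg] rook.subalg_scale[OF subalg_rook_alg])
  next
    fix v :: "rook \<Rightarrow>\<^sub>0 'a" assume "v \<in> rook_alg n"
    then show "v \<in> to_rook x n ` Ln_carrier n"
    proof (induction rule: rook_alg_induct)
      case subspace
      show ?case
      proof (rule rook.subspaceI)
        have "to_rook x n (\<lambda>D. 0) = 0" by (simp add: to_rook_def)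
        then show "0 \<in> {a. a \<in> to_rook x n ` Ln_carrier n}" by (force simp: Ln_carrier_def image_iff)
      next
        fix u v assume "u \<in> {a. a \<in> to_rook x n ` Ln_carrier n}" "v \<in> {a. a \<in> to_rook x n ` Ln_carrier n}"
        then obtain f g where fg: "f \<in> Ln_carrier n" "g \<in> Ln_carrier n" "u = to_rook x n f" "v = to_rook x n g" by blast
        then have "(\<lambda>D. f D + g D) \<in> Ln_carrier n" by (simp add: Ln_carrier_def)
        then show "u + v \<in> {a. a \<in> to_rook x n ` Ln_carrier n}" using fg to_rook_add[of x n f g] by (metis imageI mem_Collect_eq)
      next
        fix c u assume "u \<in> {a. a \<in> to_rook x n ` Ln_carrier n}"
        then obtain f where f: "f \<in> Ln_carrier n" "u = to_rook x n f" by blast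
        then have "(\<lambda>D. c * f D) \<in> Ln_carrier n" by (simp add: Ln_carrier_def)
        then show "c *\<^sub>r u \<in> {a. a \<in> to_rook x n ` Ln_carrier n}" using f to_rook_scale[of x n c f] by (metis imageI mem_Collect_eq)
      qed
    next
      case (mon r)
      define D where "D = rel_diag (rook_rel r)"
      have D: "D \<in> Ln_basis n" unfolding D_def using mon rook_rel[of r] by (intro rel_diag_in_Ln_basis) auto
      have Dr: "diag_rook D = r" by (simp add: diag_rook_def D_def rook_rel_inverse)
      define f where "f = (\<lambda>D'. if D' = D then inverse (x ^ (n - card (diag_rel D))) else 0)"
      have "to_rook x n f = (\<Sum>D'\<in>Ln_basis n. if D' = D then mon r else 0)"
        unfolding to_rook_def f_def using x Dr by (intro sum.cong refl) auto
      then have "to_rook x n f = mon r" using D finite_Ln_basis by simp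
      moreover have "f \<in> Ln_carrier n" using D by (auto simp: Ln_carrier_def f_def)
      ultimately show ?case by (metis imageI)
    qed
  qed
qed

theorem theorem4p1:
  fixes x :: "'a::field_char_0" and n :: nat
  assumes "x \<noteq> 0"
  shows "Ln_semisimple x n"
proof -
  obtain E :: "(rook \<Rightarrow>\<^sub>0 'a) set" where E: "rook.split_family (rook_alg n) E"
      "rook.corner_semiprime (rook_alg n) E" "\<Sum>E = mon (idr {1..n})"
    using rook_alg_split_family[of n] by blast
  obtain k d and \<phi> :: "(rook \<Rightarrow>\<^sub>0 'a) \<Rightarrow> nat \<Rightarrow> nat \<Rightarrow> nat \<Rightarrow> 'a" where \<phi>:
      "\<forall>i<k. d i \<ge> 1" "bij_betw \<phi> (rook_alg n) (MP_carrier k d)"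
      "\<forall>u\<in>rook_alg n. \<forall>v\<in>rook_alg n. \<phi> (u + v) = (\<lambda>i r s. \<phi> u i r s + \<phi> v i r s)"
      "\<forall>c. \<forall>u\<in>rook_alg n. \<phi> (c *\<^sub>r u) = (\<lambda>i r s. c * \<phi> u i r s)"
      "\<forall>u\<in>rook_alg n. \<forall>v\<in>rook_alg n. \<phi> (u * v) = MP_mult k d (\<phi> u) (\<phi> v)"
    using rook.split_family_imp_matrix_product[OF subalg_rook_alg E(1,2)]
    unfolding E(3) using rook_alg_unit by blast
  note bij = bij_betw_to_rook[OF assms, of n]
  have in_alg: "to_rook x n f \<in> rook_alg n" if "f \<in> Ln_carrier n" for f
    using bij that by (auto simp: bij_betw_def)
  show ?thesis
    unfolding Ln_semisimple_def
  proof (intro exI conjI ballI allI)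
    show "bij_betw (\<phi> \<circ> to_rook x n) (Ln_carrier n) (MP_carrier k d)"
      by (rule bij_betw_trans[OF bij \<phi>(2)])
  qed (use \<phi> in_alg in \<open>auto simp: to_rook_add to_rook_scale to_rook_mult\<close>)
qed

end
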